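(* Any countably infinite group $\Gamma$ has a free, minimal continuous action on the Cantor set that is not uniquely ergodic, that is, one that admits more than one ergodic invariant Borel probability measure.
   Context: An action is free if no non-identity element of the group fixes a point; a continuous action is minimal if every orbit is dense. *)

theory Defs
  imports "HOL-Probability.Probability_Measure" "HOL-Algebra.Group_Action"
begin

text \<open>
  The Cantor set is the space of binary sequences. The topology on this type is the product
  topology of the discrete two-point space, and \<open>borel\<close> is the induced Borel sigma-algebra.
\<close>

type_synonym cantor = "nat \<Rightarrow> bool"

text \<open>
  The acting group carries the discrete topology, so joint continuity of the action amounts to
  continuity of every single \<open>\<phi> g\<close> (automatically a homeomorphism, with inverse \<open>\<phi> (inv g)\<close>).
\<close>

locale continuous_action = group_action G UNIV \<phi>
  for G (structure) and \<phi> :: "'g \<Rightarrow> 'x \<Rightarrow> 'x::topological_space" +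
  assumes continuous: "g \<in> carrier G \<Longrightarrow> continuous_on UNIV (\<phi> g)"

definition free_action :: "('g, 'r) monoid_scheme \<Rightarrow> ('g \<Rightarrow> 'x \<Rightarrow> 'x) \<Rightarrow> bool" where
  "free_action G \<phi> \<longleftrightarrow> (\<forall>g \<in> carrier G. g \<noteq> \<one>\<^bsub>G\<^esub> \<longrightarrow> (\<forall>x. \<phi> g x \<noteq> x))"

definition minimal_action ::
    "('g, 'r) monoid_scheme \<Rightarrow> ('g \<Rightarrow> 'x \<Rightarrow> 'x::topological_space) \<Rightarrow> bool" where
  "minimal_action G \<phi> \<longleftrightarrow> (\<forall>x. closure (Group_Action.orbit G \<phi> x) = UNIV)"

definition invariant_borel_prob ::
    "('g, 'r) monoid_scheme \<Rightarrow> ('g \<Rightarrow> 'x \<Rightarrow> 'x::topological_space) \<Rightarrow> 'x measure \<Rightarrow> bool" where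
  "invariant_borel_prob G \<phi> \<mu> \<longleftrightarrow>
     prob_space \<mu> \<and> sets \<mu> = sets borel \<and> (\<forall>g \<in> carrier G. distr \<mu> \<mu> (\<phi> g) = \<mu>)"

definition ergodic_invariant_borel_prob ::
    "('g, 'r) monoid_scheme \<Rightarrow> ('g \<Rightarrow> 'x \<Rightarrow> 'x::topological_space) \<Rightarrow> 'x measure \<Rightarrow> bool" where
  "ergodic_invariant_borel_prob G \<phi> \<mu> \<longleftrightarrow>
     invariant_borel_prob G \<phi> \<mu> \<and>
     (\<forall>A \<in> sets borel. (\<forall>g \<in> carrier G. \<phi> g -` A = A) \<longrightarrow> measure \<mu> A = 0 \<or> measure \<mu> A = 1)"

end

theory Submission
  imports Defs "HOL-Probability.Infinite_Product_Measure"
begin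

text \<open>The space carrying the action is a closed shift-invariant set of configurations, that is, of
  labellings of the group in which every site carries infinitely many bits. Two bits are reserved
  for each group element \<open>g\<close> and read as one of four colours. Let \<open>Q\<^sub>0\<close> be the set of
  configurations whose \<open>g\<close>-colours differ at the sites \<open>d\<close> and \<open>g d\<close>, for all \<open>d\<close> and all \<open>g \<noteq> 1\<close>.
  No \<open>g \<noteq> 1\<close> fixes a point of \<open>Q\<^sub>0\<close>, so any closed invariant subset of \<open>Q\<^sub>0\<close> carries a free action.
  The two bits of the identity are left unconstrained.

  Minimality is imposed one finite pattern at a time: if the \<open>n\<close>-th pattern occurs in \<open>Q\<^sub>n\<close>, then
  \<open>Q\<^sub>n\<^sub>+\<^sub>1\<close> consists of the members of \<open>Q\<^sub>n\<close> in which it recurs within every translate of a suitable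
  finite set \<open>V\<close>. What keeps this going is flexibility: a finite piece of one configuration can be
  glued into any other by altering only finitely many sites around it. Flexibility passes from
  \<open>Q\<^sub>n\<close> to \<open>Q\<^sub>n\<^sub>+\<^sub>1\<close> because \<open>V\<close> contains \<open>W\<^sup>-\<^sup>1 D\<close>, where \<open>W\<close> is the window of the pattern and \<open>D\<close> the
  set of sites altered when the pattern is planted at the identity. Planting the pattern at a site
  that sees no occurrence within \<open>V\<close> therefore destroys no occurrence at all, and finitely many
  defects can be repaired one after the other (\<open>occurs_persists\<close>, \<open>near_repair\<close>). Every pattern
  found in \<open>X = \<Inter>\<^sub>n Q\<^sub>n\<close> is recurrent in \<open>X\<close>, so \<open>X\<close> is minimal. A free minimal compact space for
  an infinite group has no isolated points, so \<open>X\<close> is a Cantor set.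

  The measures are laws of random configurations. Let \<open>Y\<close> be the set of injective points of the
  Bernoulli shift over the unit interval. A measurable labelling \<open>f\<close> of \<open>Y\<close> yields an equivariant map
  from \<open>Y\<close> to configurations, and the image of the Bernoulli measure is invariant, and ergodic because
  the Bernoulli shift is mixing. The repairs above can be carried out measurably and equivariantly on
  \<open>Y\<close>: colour \<open>Y\<close> with countably many colours so that points of one colour are far apart, and repair
  the colour classes in turn; by locality of the rules, repairs within one class do not interfere
  (locale \<open>sweep\<close>). The sites where the pattern is planted are separated by \<open>V\<close>, so a large \<open>V\<close> makes
  the altered set small, and a labelling with values in \<open>Q\<^sub>n\<close> becomes one with values in \<open>Q\<^sub>n\<^sub>+\<^sub>1\<close> after
  an alteration on a set of measure at most \<open>2\<^sup>-\<^sup>n\<^sup>-\<^sup>3\<close> (\<open>pattern_refinement\<close>). By Borel-Cantelli these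
  labellings converge almost everywhere, to a labelling with values in \<open>X\<close> that differs from the
  initial one with probability at most \<open>1/4\<close>. Start once with the free bit constantly true and once
  with it constantly false: the two laws differ on a clopen set.\<close>

section \<open>Closed perfect subsets of the Cantor set\<close>

lemma Hausdorff_space_euclidean_fun:
  "Hausdorff_space (euclidean :: ('i \<Rightarrow> 'a::t2_space) topology)"
  unfolding Hausdorff_space_def
proof (intro allI impI)
  fix x y :: "'i \<Rightarrow> 'a"
  assume "x \<in> topspace euclidean \<and> y \<in> topspace euclidean \<and> x \<noteq> y"
  then obtain i where i: "x i \<noteq> y i" by auto
  then obtain U V where UV: "open U" "open V" "x i \<in> U" "y i \<in> V" "U \<inter> V = {}"
    using hausdorff[OF i] by auto
  show "\<exists>U V. openin euclidean U \<and> openin euclidean V \<and> x \<in> U \<and> y \<in> V \<and> disjnt U V"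
  proof (intro exI conjI)
    show "openin euclidean ((\<lambda>z. z i) -` U)" "openin euclidean ((\<lambda>z. z i) -` V)"
      by (auto intro!: open_vimage UV continuous_intros)
  qed (use UV in \<open>auto simp: disjnt_def\<close>)
qed

text \<open>Regard a closed set of binary sequences as the set of branches of a tree. The homeomorphism onto
  the full Cantor set forgets the forced bits of a branch and records only those read at the levels
  where the branch could have turned the other way.\<close>

definition split_levels :: "cantor set \<Rightarrow> cantor \<Rightarrow> nat set" where
  "split_levels X x = {n. \<exists>x'\<in>X. (\<forall>i<n. x' i = x i) \<and> x' n \<noteq> x n}"

definition branch_code :: "cantor set \<Rightarrow> cantor \<Rightarrow> cantor" where
  "branch_code X x k = x (enumerate (split_levels X x) k)"

lemma enumerate_agree:
  fixes A B :: "nat set"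
  assumes A: "infinite A" and B: "infinite B"
    and agree: "\<And>i. i \<le> enumerate A k \<Longrightarrow> i \<in> A \<longleftrightarrow> i \<in> B"
  shows "enumerate B k = enumerate A k"
  using agree
proof (induction k)
  case 0
  have "enumerate A 0 \<in> B"
    using 0[OF order_refl] enumerate_in_set[OF A, of 0] by (rule iffD1)
  then have le: "enumerate B 0 \<le> enumerate A 0"
    unfolding enumerate_0[of B] by (rule Least_le[of "\<lambda>i. i \<in> B"])
  have "enumerate B 0 \<in> A"
    using 0[OF le] enumerate_in_set[OF B, of 0] by (rule iffD2)
  then have "enumerate A 0 \<le> enumerate B 0"
    unfolding enumerate_0[of A] by (rule Least_le[of "\<lambda>i. i \<in> A"])
  with le show ?case by (rule antisym)
next
  case (Suc k)
  have lt: "enumerate A k < enumerate A (Suc k)" by (rule enumerate_step[OF A])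
  have IH: "enumerate B k = enumerate A k"
  proof (rule Suc.IH)
    fix i assume "i \<le> enumerate A k"
    then have "i \<le> enumerate A (Suc k)" using lt by (rule order.trans[OF _ less_imp_le])
    then show "i \<in> A \<longleftrightarrow> i \<in> B" by (rule Suc.prems)
  qed
  have "enumerate A (Suc k) \<in> B"
    using Suc.prems[OF order_refl] enumerate_in_set[OF A, of "Suc k"] by (rule iffD1)
  with lt have le: "enumerate B (Suc k) \<le> enumerate A (Suc k)"
    unfolding enumerate_Suc''[OF B] IH
    by (intro Least_le[of "\<lambda>s. s \<in> B \<and> enumerate A k < s"] conjI)
  have "enumerate B (Suc k) \<in> A"
    using Suc.prems[OF le] enumerate_in_set[OF B, of "Suc k"] by (rule iffD2)
  moreover have "enumerate A k < enumerate B (Suc k)"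
    using enumerate_step[OF B, of k] unfolding IH .
  ultimately have "enumerate A (Suc k) \<le> enumerate B (Suc k)"
    unfolding enumerate_Suc''[OF A]
    by (intro Least_le[of "\<lambda>s. s \<in> A \<and> enumerate A k < s"] conjI)
  with le show ?case by (rule antisym)
qed

lemma compact_UNIV_cantor: "compact (UNIV :: cantor set)"
proof -
  have "compact_space (product_topology (\<lambda>i::nat. euclidean :: bool topology) UNIV)"
    by (subst compact_space_product_topology) (auto simp: compact_space_def compactin_euclidean_iff intro: finite_imp_compact)
  then show ?thesis
    by (simp add: compact_space_def euclidean_product_topology)
qed

lemma open_cylinder: "open {x :: nat \<Rightarrow> 'a::discrete_topology. \<forall>i<n. x i = y i}"
proof -
  have "{x. \<forall>i<n. x i = y i} = (\<Inter>i\<in>{..<n}. (\<lambda>x. x i) -` {y i})" by auto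
  moreover have "open (\<Inter>i\<in>{..<n}. (\<lambda>x::nat \<Rightarrow> 'a. x i) -` {y i})"
    by (intro open_INT) (auto intro!: open_vimage open_discrete continuous_intros)
  ultimately show ?thesis by simp
qed

lemma open_cantorE:
  fixes U :: "(nat \<Rightarrow> 'a::discrete_topology) set"
  assumes "open U" "x \<in> U"
  obtains n where "{y. \<forall>i<n. y i = x i} \<subseteq> U"
proof -
  obtain X where X: "x \<in> (\<Pi>\<^sub>E i\<in>UNIV. X i)" "finite {i. X i \<noteq> UNIV}" "(\<Pi>\<^sub>E i\<in>UNIV. X i) \<subseteq> U"
    using assms(1)[unfolded open_fun_def, THEN product_topology_open_contains_basis, OF assms(2)] by auto
  obtain n where "{i. X i \<noteq> UNIV} \<subseteq> {..<n}" using X(2) unfolding finite_nat_iff_bounded by blast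
  then have n: "\<And>i. X i \<noteq> UNIV \<Longrightarrow> i < n" by blast
  have "{y. \<forall>i<n. y i = x i} \<subseteq> U"
  proof (rule order_trans[OF _ X(3)], rule subsetI)
    fix y assume "y \<in> {y. \<forall>i<n. y i = x i}"
    then have y: "\<forall>i<n. y i = x i" by simp
    have "y i \<in> X i" for i using n[of i] y X(1) by (cases "X i = UNIV") (auto simp: PiE_iff)
    then show "y \<in> (\<Pi>\<^sub>E i\<in>UNIV. X i)" by auto
  qed
  then show ?thesis by (rule that)
qed

context
  fixes X :: "cantor set"
  assumes closed: "closed X" and nonempty: "X \<noteq> {}"
    and perfect: "\<And>x n. x \<in> X \<Longrightarrow> \<exists>x'\<in>X. x' \<noteq> x \<and> (\<forall>i<n. x' i = x i)"
begin

lemma infinite_split_levels: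
  assumes "x \<in> X"
  shows "infinite (split_levels X x)"
  unfolding infinite_nat_iff_unbounded_le
proof
  fix n
  obtain x' where x': "x' \<in> X" "x' \<noteq> x" "\<forall>i<n. x' i = x i" using perfect[OF assms] by blast
  define m where "m = (LEAST i. x' i \<noteq> x i)"
  have "\<exists>i. x' i \<noteq> x i" using x'(2) by auto
  then have m: "x' m \<noteq> x m" unfolding m_def by (rule LeastI_ex)
  have "\<forall>i<m. x' i = x i" unfolding m_def by (auto dest: not_less_Least)
  then have "m \<in> split_levels X x" using m x'(1) by (auto simp: split_levels_def)
  moreover have "n \<le> m" using m x'(3) by (meson not_le)
  ultimately show "\<exists>m\<ge>n. m \<in> split_levels X x" by blast
qed

lemma split_levels_agree:
  assumes "\<forall>i<n. x' i = x i" "i < n"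
  shows "i \<in> split_levels X x' \<longleftrightarrow> i \<in> split_levels X x"
  using assms by (simp add: split_levels_def)

lemma split_levels_branch:
  assumes "x \<in> X" "x' \<in> X" "\<forall>i<n. x' i = x i" "x' n \<noteq> x n"
  shows "n \<in> split_levels X x'" "n \<in> split_levels X x"
proof -
  have "\<exists>z\<in>X. (\<forall>i<n. z i = x' i) \<and> z n \<noteq> x' n"
    by (rule bexI[OF _ assms(1)]) (use assms(3,4) in simp)
  then show "n \<in> split_levels X x'" by (simp add: split_levels_def)
  have "\<exists>z\<in>X. (\<forall>i<n. z i = x i) \<and> z n \<noteq> x n"
    by (rule bexI[OF _ assms(2)]) (use assms(3,4) in simp)
  then show "n \<in> split_levels X x" by (simp add: split_levels_def)
qed

lemma branch_code_agree:
  assumes "x \<in> X" "x' \<in> X" "\<forall>i\<le>enumerate (split_levels X x) k. x' i = x i"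
  shows "branch_code X x' k = branch_code X x k"
proof -
  have "enumerate (split_levels X x') k = enumerate (split_levels X x) k"
    using assms split_levels_agree[of "Suc (enumerate (split_levels X x) k)" x' x]
    by (intro enumerate_agree infinite_split_levels) auto
  then show ?thesis using assms(3) by (simp add: branch_code_def)
qed

text \<open>Two branches first part at a level that is a splitting level of both, with the same rank in both.
  This gives injectivity of the code; it also lets one bit of the code be changed while the earlier
  ones are kept, which gives density of the image.\<close>

lemma branch_code_first_difference:
  assumes "x \<in> X" "x' \<in> X" "\<forall>i<enumerate (split_levels X x) k. x' i = x i"
    "x' (enumerate (split_levels X x) k) \<noteq> x (enumerate (split_levels X x) k)"
  shows "branch_code X x' k \<noteq> branch_code X x k" "\<And>j. j < k \<Longrightarrow> branch_code X x' j = branch_code X x j"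
proof -
  let ?n = "enumerate (split_levels X x) k"
  have "enumerate (split_levels X x') k = ?n"
  proof (intro enumerate_agree infinite_split_levels assms(1,2))
    fix i assume "i \<le> ?n"
    then show "i \<in> split_levels X x \<longleftrightarrow> i \<in> split_levels X x'"
      using split_levels_branch[OF assms] split_levels_agree[OF assms(3), of i] by (cases "i = ?n") auto
  qed
  then show "branch_code X x' k \<noteq> branch_code X x k" using assms(4) by (simp add: branch_code_def)
  show "branch_code X x' j = branch_code X x j" if "j < k" for j
  proof (rule branch_code_agree[OF assms(1,2)])
    have "enumerate (split_levels X x) j < ?n" by (rule enumerate_mono[OF that infinite_split_levels[OF assms(1)]])
    then show "\<forall>i\<le>enumerate (split_levels X x) j. x' i = x i" using assms(3) by auto
  qed
qed

lemma inj_on_branch_code: "inj_on (branch_code X) X"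
proof (rule inj_onI, rule ccontr)
  fix x x' assume x: "x \<in> X" "x' \<in> X" "branch_code X x = branch_code X x'" "x \<noteq> x'"
  define n where "n = (LEAST i. x' i \<noteq> x i)"
  have "\<exists>i. x' i \<noteq> x i" using x(4) by auto
  then have n: "x' n \<noteq> x n" unfolding n_def by (rule LeastI_ex)
  have lt: "\<forall>i<n. x' i = x i" unfolding n_def by (auto dest: not_less_Least)
  obtain k where k: "enumerate (split_levels X x) k = n"
    using enumerate_Ex[OF infinite_split_levels[OF x(1)] split_levels_branch(2)[OF x(1,2) lt n]] by blast
  show False using branch_code_first_difference(1)[OF x(1,2), of k] lt n k x(3) by simp
qed

lemma continuous_on_branch_code: "continuous_on X (branch_code X)"
proof (rule continuous_on_coordinatewise_then_product)
  fix k
  show "continuous_on X (\<lambda>x. branch_code X x k)"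
    unfolding continuous_on_def
  proof (intro ballI)
    fix x assume x: "x \<in> X"
    let ?U = "{y. \<forall>i<Suc (enumerate (split_levels X x) k). y i = x i}"
    have "eventually (\<lambda>y. branch_code X y k = branch_code X x k) (at x within X)"
      unfolding eventually_at_topological
    proof (intro exI[of _ ?U] conjI ballI impI)
      fix y assume "y \<in> X" "y \<in> ?U"
      then show "branch_code X y k = branch_code X x k"
        by (intro branch_code_agree[OF x]) (auto simp: less_Suc_eq_le)
    qed (auto intro: open_cylinder)
    then show "((\<lambda>x. branch_code X x k) \<longlongrightarrow> branch_code X x k) (at x within X)"
      by (rule tendsto_eventually)
  qed
qed

lemma compact_perfect: "compact X"
  using compact_Int_closed[OF compact_UNIV_cantor closed] by simp

lemma branch_code_surj: "branch_code X ` X = UNIV"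
proof -
  have approx: "\<exists>x\<in>X. \<forall>j<k. branch_code X x j = b j" for b k
  proof (induction k)
    case 0
    then show ?case using nonempty by auto
  next
    case (Suc k)
    then obtain x where x: "x \<in> X" "\<forall>j<k. branch_code X x j = b j" by blast
    show ?case
    proof (cases "branch_code X x k = b k")
      case True
      then show ?thesis using x by (auto simp: less_Suc_eq)
    next
      case False
      let ?n = "enumerate (split_levels X x) k"
      have "?n \<in> split_levels X x" by (rule enumerate_in_set[OF infinite_split_levels[OF x(1)]])
      then obtain x' where x': "x' \<in> X" "\<forall>i<?n. x' i = x i" "x' ?n \<noteq> x ?n"
        by (auto simp: split_levels_def)
      note d = branch_code_first_difference[OF x(1) x'(1) x'(2) x'(3)]
      have "\<forall>j<Suc k. branch_code X x' j = b j"
        using d x(2) False by (auto simp: less_Suc_eq)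
      then show ?thesis using x'(1) by blast
    qed
  qed
  have "closed (branch_code X ` X)"
    using compact_continuous_image[OF continuous_on_branch_code compact_perfect]
      compactin_imp_closedin[OF Hausdorff_space_euclidean_fun] by simp
  moreover have "b \<in> closure (branch_code X ` X)" for b
    unfolding closure_iff_nhds_not_empty
  proof (intro allI impI)
    fix A V assume V: "V \<subseteq> A" "open V" "b \<in> V"
    obtain k where "{y. \<forall>i<k. y i = b i} \<subseteq> V" using open_cantorE[OF V(2,3)] by blast
    then show "branch_code X ` X \<inter> A \<noteq> {}" using approx[of k b] V(1) by blast
  qed
  ultimately show ?thesis by (metis closure_closed UNIV_eq_I)
qed

text \<open>The code is a continuous bijection from a compact space to a Hausdorff space.\<close>

theorem perfect_homeomorphic_cantor:
  obtains h h' where "homeomorphism X (UNIV :: cantor set) h h'"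
proof -
  have "homeomorphic_map (top_of_set X) euclidean (branch_code X)"
  proof (rule continuous_imp_homeomorphic_map)
    show "compact_space (top_of_set X)"
      using compact_perfect by (simp add: compact_space_subtopology)
    show "continuous_map (top_of_set X) euclidean (branch_code X)"
      using continuous_on_branch_code by simp
  qed (simp_all add: Hausdorff_space_euclidean_fun inj_on_branch_code branch_code_surj)
  then obtain h' where "homeomorphic_maps (top_of_set X) euclidean (branch_code X) h'"
    by (auto simp: homeomorphic_map_maps)
  then have "homeomorphism X UNIV (branch_code X) h'"
    by (intro homeomorphismI)
       (auto simp: homeomorphic_maps_def continuous_map_in_subtopology)
  then show ?thesis by (rule that)
qed

end

section \<open>Flexible sets of configurations\<close>

type_synonym config = "nat \<Rightarrow> nat \<Rightarrow> bool"

text \<open>An infinite countable group may be transported to the natural numbers. Sites, windows and group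
  elements are then numbers, and configurations and Bernoulli points are sequences.\<close>

locale nat_group = Groups.group mul one ginv
  for mul :: "nat \<Rightarrow> nat \<Rightarrow> nat" (infixl "\<cdot>" 70) and one :: nat and ginv :: "nat \<Rightarrow> nat"
begin

text \<open>Right translation of the argument makes this a left action (\<open>act_act\<close>). It is used for
  configurations as well as for the points of the Bernoulli shift.\<close>

definition act :: "nat \<Rightarrow> (nat \<Rightarrow> 'a) \<Rightarrow> nat \<Rightarrow> 'a" where
  "act g x d = x (d \<cdot> g)"

lemma act_one [simp]: "act one x = x"
  by (simp add: act_def fun_eq_iff)

lemma act_act: "act g (act h x) = act (g \<cdot> h) x"
  by (simp add: act_def fun_eq_iff assoc)

lemma mul_inv_cancel [simp]: "a \<cdot> b \<cdot> ginv b = a" "a \<cdot> ginv b \<cdot> b = a"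
    "ginv b \<cdot> (b \<cdot> a) = a" "b \<cdot> (ginv b \<cdot> a) = a"
  by (simp_all add: assoc, simp_all flip: assoc)

lemma act_inv [simp]: "act g (act (ginv g) x) = x" "act (ginv g) (act g x) = x"
  by (simp_all add: act_act)

lemma mul_eq_iff: "a \<cdot> b = c \<longleftrightarrow> b = ginv a \<cdot> c" "a \<cdot> b = c \<longleftrightarrow> a = c \<cdot> ginv b"
  by auto

definition agree :: "nat set \<Rightarrow> nat \<Rightarrow> config \<Rightarrow> config \<Rightarrow> bool" where
  "agree W N x y \<longleftrightarrow> (\<forall>w\<in>W. \<forall>c<N. x w c = y w c)"

definition agree_off :: "nat set \<Rightarrow> nat \<Rightarrow> config \<Rightarrow> config \<Rightarrow> bool" where
  "agree_off D N x y \<longleftrightarrow> (\<forall>d c. d \<notin> D \<or> c \<ge> N \<longrightarrow> x d c = y d c)"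

text \<open>A window of one member can be copied into another member while changing finitely many bits, in a
  region that depends on the window only. The region must not depend on the two members: this is what
  bounds the gaps of recurrence and the measure of the altered set.\<close>

definition gluing :: "config set \<Rightarrow> bool" where
  "gluing P \<longleftrightarrow> (\<forall>W N. finite W \<longrightarrow> (\<exists>D N'. finite D \<and>
     (\<forall>x\<in>P. \<forall>x'\<in>P. \<exists>u\<in>P. agree W N u x' \<and> agree_off D N' u x)))"

text \<open>Membership is checked on finite windows. There are infinitely many rules, one for each colour, but
  only finitely many of them involve the coordinates below \<open>N\<close>; so if only such coordinates have been
  altered, it suffices to inspect the windows \<open>E g\<close>.\<close>

definition local_rule :: "config set \<Rightarrow> bool" where
  "local_rule P \<longleftrightarrow> (\<forall>N. \<exists>E. finite E \<and> (\<forall>u.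
     (\<exists>x\<in>P. \<forall>d. \<forall>c\<ge>N. u d c = x d c) \<and> (\<forall>g. \<exists>x\<in>P. \<forall>d\<in>E. u (d \<cdot> g) = x (d \<cdot> g)) \<longrightarrow> u \<in> P))"

definition flexible :: "config set \<Rightarrow> bool" where
  "flexible P \<longleftrightarrow> closed P \<and> (\<forall>x\<in>P. \<forall>g. act g x \<in> P) \<and> gluing P \<and> local_rule P"

lemma flexibleD:
  assumes "flexible P"
  shows "closed P" "\<And>x g. x \<in> P \<Longrightarrow> act g x \<in> P" "gluing P" "local_rule P"
  using assms by (auto simp: flexible_def)

lemma agree_off_mono: "agree_off D N x y \<Longrightarrow> D \<subseteq> D' \<Longrightarrow> N \<le> N' \<Longrightarrow> agree_off D' N' x y"
  unfolding agree_off_def by (meson le_trans subsetD)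

lemma agree_off_trans:
  "agree_off D N x y \<Longrightarrow> agree_off D' N' y z \<Longrightarrow> agree_off (D \<union> D') (max N N') x z"
  by (simp add: agree_off_def)

definition setmul :: "nat set \<Rightarrow> nat set \<Rightarrow> nat set" where
  "setmul A B = (\<lambda>(a, b). a \<cdot> b) ` (A \<times> B)"

lemma finite_setmul [simp]: "finite A \<Longrightarrow> finite B \<Longrightarrow> finite (setmul A B)"
  by (simp add: setmul_def)

lemma setmulI: "a \<in> A \<Longrightarrow> b \<in> B \<Longrightarrow> a \<cdot> b \<in> setmul A B"
  by (auto simp: setmul_def)

lemma setmulE: "x \<in> setmul A B \<Longrightarrow> (\<And>a b. a \<in> A \<Longrightarrow> b \<in> B \<Longrightarrow> x = a \<cdot> b \<Longrightarrow> thesis) \<Longrightarrow> thesis"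
  by (auto simp: setmul_def)

end

lemma continuous_on_config_coordinate:
  "continuous_on UNIV (\<lambda>x::config. x a c)"
  by (rule continuous_on_product_then_coordinatewise[OF continuous_on_product_coordinates])

lemma closed_config_coordinate: "closed {x::config. x a c = b}"
  by (intro closed_Collect_eq continuous_on_config_coordinate continuous_on_const)

text \<open>The pattern consists of the coordinates below \<open>N\<close> of \<open>p\<close> on \<open>W\<close>; planting it at the identity alters
  coordinates below \<open>N'\<close> at sites in \<open>D\<close>. The assumption \<open>W\<^sup>-\<^sup>1 D \<subseteq> V\<close> says that a planted pattern
  touches only occurrences that are within \<open>V\<close> of the site of planting; symmetry of \<open>V\<close> makes
  closeness in this sense a symmetric relation.\<close>

locale pattern_step = nat_group mul one ginv
  for mul :: "nat \<Rightarrow> nat \<Rightarrow> nat" (infixl "\<cdot>" 70) and one :: nat and ginv :: "nat \<Rightarrow> nat" +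
  fixes P :: "config set" and p :: config and W :: "nat set" and N :: nat
    and D :: "nat set" and N' :: nat and V :: "nat set"
  assumes flex: "flexible P"
    and fin_W: "finite W" and fin_D: "finite D" and fin_V: "finite V"
    and W_D: "W \<subseteq> D"
    and repairable: "\<And>x. x \<in> P \<Longrightarrow> \<exists>u\<in>P. agree W N u p \<and> agree_off D N' u x"
    and one_V: "one \<in> V"
    and inv_V: "\<And>v. v \<in> V \<Longrightarrow> ginv v \<in> V"
    and W_D_V: "\<And>w d. w \<in> W \<Longrightarrow> d \<in> D \<Longrightarrow> ginv w \<cdot> d \<in> V"
begin

definition occurs :: "config \<Rightarrow> bool" where
  "occurs x \<longleftrightarrow> agree W N x p"

definition near :: "config \<Rightarrow> bool" where
  "near x \<longleftrightarrow> (\<exists>v\<in>V. occurs (act v x))"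

definition syndetic :: "config set" where
  "syndetic = {x \<in> P. \<forall>g. near (act g x)}"

lemma occurs_act_cong:
  assumes "\<And>w c. w \<in> W \<Longrightarrow> c < N \<Longrightarrow> x (w \<cdot> g) c = y (w \<cdot> g) c"
  shows "occurs (act g x) \<longleftrightarrow> occurs (act g y)"
  using assms by (auto simp: occurs_def agree_def act_def)

text \<open>An occurrence at \<open>g\<close> that is damaged by planting at \<open>z\<close> has \<open>w g = d z\<close> with \<open>w \<in> W\<close> and \<open>d \<in> D\<close>,
  hence lies at \<open>w\<^sup>-\<^sup>1 d z\<close>, within \<open>V\<close> of \<open>z\<close>; but the pattern is planted only where there is none.\<close>

lemma occurs_persists:
  assumes "\<not> near (act z x)" and off: "\<And>a. y a \<noteq> x a \<Longrightarrow> \<exists>d\<in>D. a = d \<cdot> z"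
    and "occurs (act g x)"
  shows "occurs (act g y)"
proof (rule ccontr)
  assume *: "\<not> ?thesis"
  have "\<exists>w\<in>W. y (w \<cdot> g) \<noteq> x (w \<cdot> g)"
    using occurs_act_cong[of x g y] * assms(3) by metis
  then obtain w d where w: "w \<in> W" "d \<in> D" "w \<cdot> g = d \<cdot> z" using off by blast
  then have "g = ginv w \<cdot> d \<cdot> z" by (metis assoc mul_eq_iff(1))
  then have "act g x = act (ginv w \<cdot> d) (act z x)" by (simp add: act_act)
  then have "near (act z x)"
    unfolding near_def using W_D_V[OF w(1,2)] assms(3) by metis
  with assms(1) show False by contradiction
qed

text \<open>Each planting removes at least one defect and creates none, so finitely many defects disappear after
  finitely many steps.\<close>

lemma near_repair:
  assumes x: "x \<in> P" and bad: "finite {g. \<not> near (act g x)}"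
  shows "\<exists>u\<in>syndetic. agree_off (setmul D {g. \<not> near (act g x)}) N' u x"
  using x bad
proof (induction "card {g. \<not> near (act g x)}" arbitrary: x rule: less_induct)
  case less
  show ?case
  proof (cases "{g. \<not> near (act g x)} = {}")
    case True
    then have "x \<in> syndetic" using less.prems by (auto simp: syndetic_def)
    then show ?thesis by (auto simp: agree_off_def)
  next
    case False
    then obtain z where z: "\<not> near (act z x)" by blast
    obtain r where r: "r \<in> P" "occurs r" "agree_off D N' r (act z x)"
      using repairable[OF flexibleD(2)[OF flex less.prems(1)]] unfolding occurs_def by blast
    define y where "y = act (ginv z) r"
    have yP: "y \<in> P" unfolding y_def by (rule flexibleD(2)[OF flex r(1)])
    have y_eq: "y a c = x a c" if "(\<nexists>d. d \<in> D \<and> a = d \<cdot> z) \<or> c \<ge> N'" for a c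
    proof -
      have "a \<cdot> ginv z \<notin> D \<or> c \<ge> N'" using that by (metis mul_eq_iff(2))
      then have "r (a \<cdot> ginv z) c = act z x (a \<cdot> ginv z) c" using r(3) unfolding agree_off_def by blast
      then show ?thesis by (simp add: y_def act_def)
    qed
    have persist: "near (act g y)" if nx: "near (act g x)" for g
    proof -
      obtain v where v: "v \<in> V" "occurs (act v (act g x))" using nx by (auto simp: near_def)
      have "occurs (act (v \<cdot> g) y)"
      proof (rule occurs_persists[OF z])
        show "\<exists>d\<in>D. a = d \<cdot> z" if "y a \<noteq> x a" for a
          using that y_eq[of a] by (auto simp: fun_eq_iff)
        show "occurs (act (v \<cdot> g) x)" using v(2) by (simp add: act_act)
      qed
      then show ?thesis using v(1) by (auto simp: near_def act_act)
    qed
    have "near (act z y)"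
      using r(2) one_V unfolding near_def y_def by (auto intro!: bexI[of _ one])
    then have sub: "{g. \<not> near (act g y)} \<subset> {g. \<not> near (act g x)}"
      using z persist by blast
    then have "\<exists>u\<in>syndetic. agree_off (setmul D {g. \<not> near (act g y)}) N' u y"
      using less.prems by (intro less.hyps psubset_card_mono yP) (auto intro: finite_subset)
    then obtain u where u: "u \<in> syndetic" "agree_off (setmul D {g. \<not> near (act g y)}) N' u y" by blast
    have "agree_off (setmul D {g. \<not> near (act g x)}) N' u y"
      using u(2) sub by (rule_tac agree_off_mono) (auto simp: setmul_def)
    moreover have "agree_off (setmul D {g. \<not> near (act g x)}) N' y x"
      using y_eq z unfolding agree_off_def by (metis mem_Collect_eq setmulI)
    ultimately have "agree_off (setmul D {g. \<not> near (act g x)}) N' u x"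
      using agree_off_trans by fastforce
    then show ?thesis using u(1) by blast
  qed
qed

text \<open>Glue first inside \<open>P\<close>, then repair. Away from the glued region every site sees the occurrences of
  \<open>x\<close>, and deep inside it those of \<open>x'\<close>; so defects occur only in a finite set along the border. Gluing
  along the larger window \<open>F\<close> keeps the border so far from the target window \<open>A\<close> that the repairs do
  not reach \<open>A\<close>.\<close>

lemma gluing_syndetic: "gluing syndetic"
  unfolding gluing_def
proof (intro allI impI)
  fix A :: "nat set" and K :: nat assume "finite A"
  define WV where "WV = setmul W V"
  define F where "F = A \<union> setmul WV (setmul (ginv ` D) A)"
  have fin: "finite WV" "finite F" using \<open>finite A\<close> fin_W fin_D fin_V by (auto simp: WV_def F_def)
  obtain D1 N1 where D1: "finite D1"
    and glue: "\<And>x x'. x \<in> P \<Longrightarrow> x' \<in> P \<Longrightarrow> \<exists>u\<in>P. agree F (max K N) u x' \<and> agree_off D1 N1 u x"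
    using flexibleD(3)[OF flex] fin(2) unfolding gluing_def by metis
  define B where "B = setmul (ginv ` WV) D1"
  have "\<exists>u\<in>syndetic. agree A K u x' \<and> agree_off (D1 \<union> setmul D B) (max N1 N') u x"
    if x: "x \<in> syndetic" "x' \<in> syndetic" for x x'
  proof -
    have xP: "x \<in> P" "x' \<in> P" using x by (auto simp: syndetic_def)
    obtain u where u: "u \<in> P" "agree F (max K N) u x'" "agree_off D1 N1 u x" using glue[OF xP] by blast
    have bad_B: "g \<in> B" if "\<not> near (act g u)" for g
    proof (rule ccontr)
      assume g: "g \<notin> B"
      obtain v where v: "v \<in> V" "occurs (act (v \<cdot> g) x)"
        using x(1) by (auto simp: syndetic_def near_def act_act)
      have "occurs (act (v \<cdot> g) u)"
      proof (rule iffD1[OF occurs_act_cong v(2)])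
        fix w c assume w: "w \<in> W" "c < N"
        have "w \<cdot> (v \<cdot> g) \<notin> D1"
        proof
          assume "w \<cdot> (v \<cdot> g) \<in> D1"
          then have "ginv (w \<cdot> v) \<cdot> (w \<cdot> (v \<cdot> g)) \<in> B"
            unfolding B_def WV_def using w(1) v(1) by (intro setmulI imageI)
          moreover have "ginv (w \<cdot> v) \<cdot> (w \<cdot> (v \<cdot> g)) = g"
            using mul_inv_cancel(3)[of "w \<cdot> v" g] by (simp only: assoc)
          ultimately show False using g by simp
        qed
        then show "x (w \<cdot> (v \<cdot> g)) c = u (w \<cdot> (v \<cdot> g)) c" using u(3) by (simp add: agree_off_def)
      qed
      then show False using that v(1) by (auto simp: near_def act_act)
    qed
    \<comment> \<open>If a repair at \<open>g\<close> could reach \<open>A\<close>, then all of \<open>W V g\<close> would lie in \<open>F\<close>, where \<open>u\<close> copies \<open>x'\<close>.\<close>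
    have bad_A: "d \<cdot> g \<notin> A" if "\<not> near (act g u)" "d \<in> D" for d g
    proof
      assume dg: "d \<cdot> g \<in> A"
      obtain v where v: "v \<in> V" "occurs (act (v \<cdot> g) x')"
        using x(2) by (auto simp: syndetic_def near_def act_act)
      have "occurs (act (v \<cdot> g) u)"
      proof (rule iffD1[OF occurs_act_cong v(2)])
        fix w c assume w: "w \<in> W" "c < N"
        have "(w \<cdot> v) \<cdot> (ginv d \<cdot> (d \<cdot> g)) \<in> F"
          unfolding F_def WV_def using w(1) v(1) dg that(2) by (intro UnI2 setmulI imageI)
        then have "w \<cdot> (v \<cdot> g) \<in> F" by (simp add: assoc)
        then show "x' (w \<cdot> (v \<cdot> g)) c = u (w \<cdot> (v \<cdot> g)) c" using u(2) w(2) by (simp add: agree_def)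
      qed
      then show False using that v(1) by (auto simp: near_def act_act)
    qed
    have "finite B" using D1 fin by (simp add: B_def)
    then have "finite {g. \<not> near (act g u)}" by (rule rev_finite_subset) (use bad_B in blast)
    then obtain u' where u': "u' \<in> syndetic" "agree_off (setmul D {g. \<not> near (act g u)}) N' u' u"
      using near_repair[OF u(1)] by blast
    have "agree A K u' x'"
      unfolding agree_def
    proof (intro ballI allI impI)
      fix a c assume a: "a \<in> A" "c < K"
      have "a \<notin> setmul D {g. \<not> near (act g u)}" using bad_A a(1) by (auto elim!: setmulE)
      then have "u' a c = u a c" using u'(2) by (simp add: agree_off_def)
      also have "\<dots> = x' a c" using u(2) a by (simp add: agree_def F_def)
      finally show "u' a c = x' a c" .
    qed
    moreover have "agree_off (D1 \<union> setmul D B) (max N1 N') u' x"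
    proof (rule agree_off_mono[OF agree_off_trans[OF u'(2) u(3)]])
      show "setmul D {g. \<not> near (act g u)} \<union> D1 \<subseteq> D1 \<union> setmul D B"
        using bad_B by (auto simp: setmul_def)
    qed simp
    ultimately show ?thesis using u'(1) by blast
  qed
  moreover have "finite (D1 \<union> setmul D B)" using D1 fin fin_D by (simp add: B_def)
  ultimately show "\<exists>D N'. finite D \<and> (\<forall>x\<in>syndetic. \<forall>x'\<in>syndetic. \<exists>u\<in>syndetic. agree A K u x' \<and> agree_off D N' u x)"
    by blast
qed

lemma local_rule_syndetic: "local_rule syndetic"
  unfolding local_rule_def
proof
  fix K
  obtain E where E: "finite E" and loc: "\<forall>u. (\<exists>x\<in>P. \<forall>d. \<forall>c\<ge>K. u d c = x d c) \<and>
      (\<forall>g. \<exists>x\<in>P. \<forall>d\<in>E. u (d \<cdot> g) = x (d \<cdot> g)) \<longrightarrow> u \<in> P"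
    using flexibleD(4)[OF flex, unfolded local_rule_def, THEN spec[of _ K]] by (elim exE conjE)
  have main: "u \<in> syndetic" if u1: "\<exists>x\<in>syndetic. \<forall>d. \<forall>c\<ge>K. u d c = x d c"
    and u2: "\<forall>g. \<exists>x\<in>syndetic. \<forall>d\<in>E \<union> setmul W V. u (d \<cdot> g) = x (d \<cdot> g)" for u
  proof -
    have sub: "syndetic \<subseteq> P" by (auto simp: syndetic_def)
    have "u \<in> P"
    proof (rule loc[THEN spec, THEN mp], intro conjI allI)
      show "\<exists>x\<in>P. \<forall>d. \<forall>c\<ge>K. u d c = x d c" by (rule bexE[OF u1]) (use sub in blast)
      fix g
      obtain x where x: "x \<in> syndetic" "\<forall>d\<in>E \<union> setmul W V. u (d \<cdot> g) = x (d \<cdot> g)" using u2 by blast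
      show "\<exists>x\<in>P. \<forall>d\<in>E. u (d \<cdot> g) = x (d \<cdot> g)"
        by (rule bexI[of _ x]) (use x sub in auto)
    qed
    moreover have "near (act g u)" for g
    proof -
      obtain x where x: "x \<in> syndetic" "\<forall>d\<in>E \<union> setmul W V. u (d \<cdot> g) = x (d \<cdot> g)" using u2 by blast
      obtain v where v: "v \<in> V" "occurs (act (v \<cdot> g) x)"
        using x(1) by (auto simp: syndetic_def near_def act_act)
      have "occurs (act (v \<cdot> g) u)"
      proof (rule iffD1[OF occurs_act_cong v(2)])
        fix w c assume w: "w \<in> W" "c < N"
        then show "x (w \<cdot> (v \<cdot> g)) c = u (w \<cdot> (v \<cdot> g)) c"
          using x(2) setmulI[OF w(1) v(1)] by (simp flip: assoc)
      qed
      then show ?thesis using v(1) by (auto simp: near_def act_act)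
    qed
    ultimately show ?thesis by (simp add: syndetic_def)
  qed
  show "\<exists>E. finite E \<and> (\<forall>u. (\<exists>x\<in>syndetic. \<forall>d. \<forall>c\<ge>K. u d c = x d c) \<and>
    (\<forall>g. \<exists>x\<in>syndetic. \<forall>d\<in>E. u (d \<cdot> g) = x (d \<cdot> g)) \<longrightarrow> u \<in> syndetic)"
  proof (intro exI[of _ "E \<union> setmul W V"] conjI allI impI)
    show "finite (E \<union> setmul W V)" using E fin_W fin_V by simp
  qed (elim conjE, rule main)
qed

lemma closed_near: "closed {x. near x}"
proof -
  have "{x. near x} = (\<Union>v\<in>V. \<Inter>w\<in>W. \<Inter>c\<in>{..<N}. {x. x (w \<cdot> v) c = p w c})"
    by (auto simp: near_def occurs_def agree_def act_def)
  also have "closed \<dots>" by (intro closed_UN closed_INT ballI fin_V closed_config_coordinate)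
  finally show ?thesis .
qed

lemma flexible_syndetic: "flexible syndetic"
  unfolding flexible_def
proof (intro conjI gluing_syndetic local_rule_syndetic ballI allI)
  have "syndetic = P \<inter> (\<Inter>g. \<Union>v\<in>V. \<Inter>w\<in>W. \<Inter>c\<in>{..<N}. {x. x (w \<cdot> v \<cdot> g) c = p w c})"
    by (simp add: set_eq_iff syndetic_def near_def occurs_def agree_def act_def Ball_def[of "{..<N}"])
  also have "closed \<dots>"
    by (intro closed_Int flexibleD(1)[OF flex] closed_INT closed_UN ballI fin_V closed_config_coordinate)
  finally show "closed syndetic" .
  show "act g x \<in> syndetic" if "x \<in> syndetic" for g x
    using that flexibleD(2)[OF flex] by (simp add: syndetic_def act_act)
qed

end

section \<open>Configurations with trivial stabilisers\<close>

context nat_group begin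

definition colour :: "config \<Rightarrow> nat \<Rightarrow> nat \<Rightarrow> bool \<times> bool" where
  "colour x g d = (x d (2 * g), x d (2 * g + 1))"

definition coloured :: "config set" where
  "coloured = {x. \<forall>g d. g \<noteq> one \<longrightarrow> colour x g (g \<cdot> d) \<noteq> colour x g d}"

lemma coloured_free:
  assumes "x \<in> coloured" "g \<noteq> one"
  shows "act g x \<noteq> x"
proof
  assume *: "act g x = x"
  have "x g = act g x one" by (simp add: act_def)
  then have "x g = x one" using * by simp
  moreover have "colour x g (g \<cdot> one) \<noteq> colour x g one" using assms unfolding coloured_def by blast
  ultimately show False by (simp add: colour_def)
qed

lemma third_colour: "\<exists>k :: bool \<times> bool. k \<noteq> a \<and> k \<noteq> b"
proof -
  have "card {a, b} \<le> 2" by (simp add: card_insert_if)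
  moreover have "card (UNIV :: (bool \<times> bool) set) = 4" by (simp flip: UNIV_Times_UNIV)
  ultimately have "{a, b} \<noteq> UNIV" by auto
  then show ?thesis by blast
qed

text \<open>The graph joining \<open>d\<close> to \<open>g d\<close> has degree at most two, so a site can always be given a colour
  different from those of its neighbours. Recolouring the sites of \<open>B\<close> one by one therefore removes
  all conflicts that meet \<open>B\<close>.\<close>

lemma recolour:
  fixes u :: "nat \<Rightarrow> bool \<times> bool"
  assumes g: "g \<noteq> one" and "finite B"
    and "\<And>d. u (g \<cdot> d) = u d \<Longrightarrow> d \<in> B \<or> g \<cdot> d \<in> B"
  shows "\<exists>u'. (\<forall>d. d \<notin> B \<longrightarrow> u' d = u d) \<and> (\<forall>d. u' (g \<cdot> d) \<noteq> u' d)"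
  using assms(2,3)
proof (induction B arbitrary: u rule: finite_induct)
  case empty
  then show ?case by auto
next
  case (insert b B)
  obtain k where k: "k \<noteq> u (g \<cdot> b)" "k \<noteq> u (ginv g \<cdot> b)" using third_colour by blast
  have nb: "g \<cdot> b \<noteq> b" using g by (metis mul_inv_cancel(1) right_inverse)
  have "\<exists>u'. (\<forall>d. d \<notin> B \<longrightarrow> u' d = (u(b := k)) d) \<and> (\<forall>d. u' (g \<cdot> d) \<noteq> u' d)"
  proof (rule insert.IH)
    fix d assume d: "(u(b := k)) (g \<cdot> d) = (u(b := k)) d"
    have "d \<noteq> b" using d k(1) nb by auto
    have "g \<cdot> d \<noteq> b"
    proof
      assume "g \<cdot> d = b"
      then have "d = ginv g \<cdot> b" by (simp flip: mul_eq_iff(1))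
      then show False using d k(2) \<open>g \<cdot> d = b\<close> \<open>d \<noteq> b\<close> by (metis fun_upd_def)
    qed
    with \<open>d \<noteq> b\<close> have "u (g \<cdot> d) = u d" using d by simp
    then show "d \<in> B \<or> g \<cdot> d \<in> B" using insert.prems[of d] \<open>d \<noteq> b\<close> \<open>g \<cdot> d \<noteq> b\<close> by blast
  qed
  then obtain u' where "\<forall>d. d \<notin> B \<longrightarrow> u' d = (u(b := k)) d" "\<forall>d. u' (g \<cdot> d) \<noteq> u' d" by blast
  then show ?case by (intro exI[of _ u']) simp
qed

text \<open>Conflicts between the two colourings can only arise across the boundary of \<open>W\<close>; the outer boundary
  is recoloured.\<close>

lemma glue_colouring:
  fixes u u' :: "nat \<Rightarrow> bool \<times> bool"
  assumes g: "g \<noteq> one" and W: "finite W"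
    and u: "\<And>d. u (g \<cdot> d) \<noteq> u d" and u': "\<And>d. u' (g \<cdot> d) \<noteq> u' d"
  shows "\<exists>v. (\<forall>d\<in>W. v d = u' d) \<and> (\<forall>d. d \<notin> W \<union> setmul {g, ginv g} W \<longrightarrow> v d = u d)
    \<and> (\<forall>d. v (g \<cdot> d) \<noteq> v d)"
proof -
  let ?u = "\<lambda>d. if d \<in> W then u' d else u d" and ?B = "setmul {g, ginv g} W - W"
  have "\<exists>v. (\<forall>d. d \<notin> ?B \<longrightarrow> v d = ?u d) \<and> (\<forall>d. v (g \<cdot> d) \<noteq> v d)"
  proof (rule recolour[OF g])
    show "finite ?B" using W by simp
    fix d assume d: "?u (g \<cdot> d) = ?u d"
    show "d \<in> ?B \<or> g \<cdot> d \<in> ?B"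
    proof (cases "d \<in> W")
      case True
      then have "g \<cdot> d \<notin> W" using d u'[of d] by auto
      then show ?thesis using True setmulI[of g "{g, ginv g}" d W] by blast
    next
      case False
      then have "g \<cdot> d \<in> W" using d u[of d] by (auto split: if_splits)
      then have "ginv g \<cdot> (g \<cdot> d) \<in> setmul {g, ginv g} W" by (intro setmulI) auto
      then show ?thesis using False by simp
    qed
  qed
  then obtain v where v: "\<And>d. d \<notin> ?B \<Longrightarrow> v d = ?u d" "\<And>d. v (g \<cdot> d) \<noteq> v d" by blast
  show ?thesis by (rule exI[of _ v]) (simp add: v)
qed

lemma closed_coloured: "closed coloured"
proof -
  have "coloured = (\<Inter>g\<in>-{one}. \<Inter>d. (\<lambda>x. (x (g \<cdot> d) (2 * g) \<noteq> x d (2 * g)) \<or> (x (g \<cdot> d) (2 * g + 1) \<noteq> x d (2 * g + 1))) -` {True})"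
    by (auto simp: coloured_def colour_def)
  also have "closed \<dots>"
  proof (intro closed_INT ballI)
    fix g d :: nat
    have *: "(\<lambda>x::config. (x (g \<cdot> d) (2 * g) \<noteq> x d (2 * g)) \<or> (x (g \<cdot> d) (2 * g + 1) \<noteq> x d (2 * g + 1))) -` {True}
      = (\<Union>b. {x. x (g \<cdot> d) (2 * g) = b} \<inter> {x. x d (2 * g) = (\<not> b)}) \<union>
        (\<Union>b. {x. x (g \<cdot> d) (2 * g + 1) = b} \<inter> {x. x d (2 * g + 1) = (\<not> b)})"
      by auto
    show "closed ((\<lambda>x::config. (x (g \<cdot> d) (2 * g) \<noteq> x d (2 * g)) \<or> (x (g \<cdot> d) (2 * g + 1) \<noteq> x d (2 * g + 1))) -` {True})"
      unfolding * by (intro closed_Un closed_UN closed_Int closed_config_coordinate ballI) auto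
  qed
  finally show ?thesis .
qed

lemma gluing_coloured: "gluing coloured"
  unfolding gluing_def
proof (intro allI impI)
  fix W :: "nat set" and N assume W: "finite W"
  let ?D = "W \<union> setmul ({..<N} \<union> ginv ` {..<N}) W"
  have "\<exists>u\<in>coloured. agree W N u x' \<and> agree_off ?D (2 * N) u x" if x: "x \<in> coloured" "x' \<in> coloured" for x x'
  proof -
    have "\<exists>v. (\<forall>d\<in>W. v d = colour x' g d) \<and> (\<forall>d. d \<notin> ?D \<longrightarrow> v d = colour x g d)
      \<and> (g \<noteq> one \<longrightarrow> (\<forall>d. v (g \<cdot> d) \<noteq> v d))" if "g < N" for g
    proof (cases "g = one")
      case True
      then show ?thesis by (intro exI[of _ "\<lambda>d. if d \<in> W then colour x' g d else colour x g d"]) auto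
    next
      case False
      have "\<exists>v. (\<forall>d\<in>W. v d = colour x' g d)
          \<and> (\<forall>d. d \<notin> W \<union> setmul {g, ginv g} W \<longrightarrow> v d = colour x g d) \<and> (\<forall>d. v (g \<cdot> d) \<noteq> v d)"
        by (rule glue_colouring[OF False W]) (use x False in \<open>auto simp: coloured_def\<close>)
      then obtain v where v: "\<forall>d\<in>W. v d = colour x' g d"
        "\<forall>d. d \<notin> W \<union> setmul {g, ginv g} W \<longrightarrow> v d = colour x g d" "\<forall>d. v (g \<cdot> d) \<noteq> v d" by blast
      have "setmul {g, ginv g} W \<subseteq> setmul ({..<N} \<union> ginv ` {..<N}) W"
        using that unfolding setmul_def by auto
      then show ?thesis using v by (intro exI[of _ v]) blast
    qed
    then obtain v where v: "\<And>g d. g < N \<Longrightarrow> d \<in> W \<Longrightarrow> v g d = colour x' g d"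
      "\<And>g d. g < N \<Longrightarrow> d \<notin> ?D \<Longrightarrow> v g d = colour x g d"
      "\<And>g d. g < N \<Longrightarrow> g \<noteq> one \<Longrightarrow> v g (g \<cdot> d) \<noteq> v g d" by metis
    define u :: config where "u = (\<lambda>d c. if c div 2 < N then
      (if even c then fst (v (c div 2) d) else snd (v (c div 2) d)) else x d c)"
    have u_colour: "colour u g d = (if g < N then v g d else colour x g d)" for g d
      by (simp add: u_def colour_def)
    have "u \<in> coloured" using v(3) x(1) by (simp add: coloured_def u_colour)
    moreover have "agree W N u x'"
      unfolding agree_def
    proof (intro ballI allI impI)
      fix d c assume d: "d \<in> W" "c < N"
      then have "c div 2 < N" by (meson div_le_dividend le_less_trans)
      then have "colour u (c div 2) d = colour x' (c div 2) d" by (simp add: u_colour v(1) d)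
      then show "u d c = x' d c" by (cases "even c") (auto simp: colour_def elim: evenE oddE)
    qed
    moreover have "agree_off ?D (2 * N) u x"
      unfolding agree_off_def
    proof (intro allI impI)
      fix d c assume d: "d \<notin> ?D \<or> c \<ge> 2 * N"
      have "colour u (c div 2) d = colour x (c div 2) d" using d v(2)[of "c div 2" d] by (auto simp: u_colour)
      then show "u d c = x d c" by (cases "even c") (auto simp: colour_def elim: evenE oddE)
    qed
    ultimately show ?thesis by blast
  qed
  moreover have "finite ?D" using W by simp
  ultimately show "\<exists>D N'. finite D \<and> (\<forall>x\<in>coloured. \<forall>x'\<in>coloured. \<exists>u\<in>coloured. agree W N u x' \<and> agree_off D N' u x)"
    by blast
qed

lemma local_rule_coloured: "local_rule coloured"
  unfolding local_rule_def
proof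
  fix N
  let ?E = "insert one {..<N}"
  have "u \<in> coloured" if u1: "x \<in> coloured" "\<forall>d. \<forall>c\<ge>N. u d c = x d c"
    and u2: "\<forall>g. \<exists>x\<in>coloured. \<forall>d\<in>?E. u (d \<cdot> g) = x (d \<cdot> g)" for u x
    unfolding coloured_def mem_Collect_eq
  proof (intro allI impI)
    fix g d assume g: "g \<noteq> one"
    show "colour u g (g \<cdot> d) \<noteq> colour u g d"
    proof (cases "g < N")
      case True
      obtain x' where x': "x' \<in> coloured" "\<forall>a\<in>?E. u (a \<cdot> d) = x' (a \<cdot> d)" using u2 by blast
      have "colour x' g (g \<cdot> d) \<noteq> colour x' g d" using x'(1) g by (simp add: coloured_def)
      moreover have "u (g \<cdot> d) = x' (g \<cdot> d)" using x'(2) True by blast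
      moreover have "u d = x' d" using x'(2) by (metis group_left_neutral insertI1)
      ultimately show ?thesis by (simp add: colour_def)
    next
      case False
      then have "colour u g = colour x g" using u1(2) by (simp add: colour_def fun_eq_iff)
      then show ?thesis using u1(1) g by (simp add: coloured_def)
    qed
  qed
  then show "\<exists>E. finite E \<and> (\<forall>u. (\<exists>x\<in>coloured. \<forall>d. \<forall>c\<ge>N. u d c = x d c) \<and>
     (\<forall>g. \<exists>x\<in>coloured. \<forall>d\<in>E. u (d \<cdot> g) = x (d \<cdot> g)) \<longrightarrow> u \<in> coloured)"
    by (intro exI[of _ ?E]) auto
qed

lemma flexible_coloured: "flexible coloured"
  unfolding flexible_def
proof (intro conjI closed_coloured gluing_coloured local_rule_coloured ballI allI)
  show "act g x \<in> coloured" if "x \<in> coloured" for g x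
    using that by (simp add: coloured_def colour_def act_def assoc)
qed

end

section \<open>The Bernoulli shift over the unit interval\<close>

definition unif :: "real measure" where
  "unif = uniform_measure lborel {0..<1}"

definition bernoulli :: "(nat \<Rightarrow> real) measure" where
  "bernoulli = PiM UNIV (\<lambda>_. unif)"

lemma prob_space_unif: "prob_space unif"
  unfolding unif_def by (rule prob_space_uniform_measure) simp_all

lemma sets_unif [measurable_cong, simp]: "sets unif = sets borel"
  by (simp add: unif_def)

lemma space_unif [simp]: "space unif = UNIV"
  by (simp add: unif_def)

interpretation B: prob_space bernoulli
  unfolding bernoulli_def by (rule prob_space_PiM) (rule prob_space_unif)

lemma sets_bernoulli [measurable_cong, simp]: "sets bernoulli = sets borel"
  unfolding bernoulli_def sets_PiM_equal_borel[symmetric]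
  by (intro sets_PiM_cong) simp_all

lemma space_bernoulli [simp]: "space bernoulli = UNIV"
  by (simp add: bernoulli_def space_PiM)

lemma emb_eq_box: "prod_emb UNIV (\<lambda>_. unif) J (Pi\<^sub>E J E) = {y. \<forall>j\<in>J. y j \<in> E j}"
  by (auto simp: prod_emb_def PiE_iff)

lemma measure_box:
  assumes "finite J" "\<And>j. j \<in> J \<Longrightarrow> E j \<in> sets borel"
  shows "measure bernoulli {y. \<forall>j\<in>J. y j \<in> E j} = (\<Prod>j\<in>J. measure unif (E j))"
proof -
  interpret U: prob_space unif by (rule prob_space_unif)
  interpret product_prob_space "\<lambda>_. unif" UNIV by unfold_locales
  show ?thesis
    using measure_PiM_emb[of J E] assms by (simp add: emb_eq_box bernoulli_def)
qed

text \<open>Cut the unit interval into \<open>n\<close> equal pieces: two coordinates fall into the same piece with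
  probability \<open>n \<cdot> n\<^sup>-\<^sup>2\<close>.\<close>

lemma AE_coordinates_distinct:
  assumes "i \<noteq> j"
  shows "AE y in bernoulli. y i \<noteq> y j"
proof -
  have unit: "AE y in bernoulli. y i \<in> {0..<1}"
  proof -
    have "measure bernoulli {y. \<forall>k\<in>{i}. y k \<in> {0..<1}} = 1"
      by (subst measure_box) (auto simp: unif_def measure_uniform_measure)
    then have "AE y in bernoulli. y \<in> {y. \<forall>k\<in>{i}. y k \<in> {0..<1}}"
      by (intro B.AE_prob_1)
    then show ?thesis by simp
  qed
  define A where "A = {y \<in> space bernoulli. y i = y j \<and> y i \<in> {0..<1}}"
  have A_sets: "A \<in> sets borel"
  proof -
    have "{y \<in> space borel. y i = y j} \<inter> (\<lambda>y. y i) -` {0..<1} \<in> sets (borel :: (nat \<Rightarrow> real) measure)"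
      by (intro sets.Int borel_measurable_eq measurable_product_coordinates
          measurable_sets_borel[OF measurable_product_coordinates]) auto
    also have "{y \<in> space borel. y i = y j} \<inter> (\<lambda>y. y i) -` {0..<1} = A" by (auto simp: A_def)
    finally show ?thesis .
  qed
  have le: "measure bernoulli A \<le> 1 / real n" if n: "n > 0" for n
  proof -
    let ?E = "\<lambda>k::nat. {real k / n..<real (Suc k) / n}"
    let ?B = "\<lambda>k. {y :: nat \<Rightarrow> real. \<forall>l\<in>{i, j}. y l \<in> ?E k}"
    have "measure unif (?E k) = 1 / n" if "k < n" for k
    proof -
      have "real (Suc k) / n \<le> 1" using that by simp
      then have "{0..<1} \<inter> ?E k = ?E k" by (auto intro: order_trans)
      then show ?thesis
        using n by (simp add: unif_def measure_uniform_measure divide_right_mono field_simps)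
    qed
    then have B: "measure bernoulli (?B k) = 1 / (real n)^2" if "k < n" for k
      using that assms by (subst measure_box) (auto simp: power2_eq_square)
    have "A \<subseteq> (\<Union>k\<in>{..<n}. ?B k)"
    proof
      fix y assume "y \<in> A"
      then have y: "y i = y j" "0 \<le> y i" "y i < 1" by (auto simp: A_def)
      define k where "k = nat \<lfloor>real n * y i\<rfloor>"
      have k: "real k \<le> real n * y i" "real n * y i < real (Suc k)"
        using y by (auto simp: k_def) linarith+
      have "real n * y i < real n" using y(3) n by simp
      with k(1) have "k < n" by linarith
      moreover have "y \<in> ?B k" using k n y(1) by (auto simp: field_simps)
      ultimately show "y \<in> (\<Union>k\<in>{..<n}. ?B k)" by blast
    qed
    then have "measure bernoulli A \<le> measure bernoulli (\<Union>k\<in>{..<n}. ?B k)"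
      by (intro B.finite_measure_mono) auto
    also have "\<dots> \<le> (\<Sum>k<n. measure bernoulli (?B k))"
      by (intro B.finite_measure_subadditive_finite) auto
    also have "\<dots> = 1 / n" using B n by (simp add: power2_eq_square)
    finally show ?thesis .
  qed
  have "measure bernoulli A \<le> 0"
  proof (rule field_le_epsilon)
    fix e :: real assume "0 < e"
    obtain n where n: "n > 0" "1 / real n < e" using \<open>0 < e\<close> by (metis nat_approx_posE zero_less_Suc)
    then show "measure bernoulli A \<le> 0 + e" using le[OF n(1)] by simp
  qed
  then have "A \<in> null_sets bernoulli"
    by (intro null_setsI) (auto simp: B.emeasure_eq_measure A_sets antisym)
  then have "AE y in bernoulli. y \<notin> A" by (rule AE_not_in)
  with unit show ?thesis by eventually_elim (auto simp: A_def)
qed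

text \<open>On injective sequences the group acts freely, since \<open>act g y\<close> takes the value \<open>y g\<close> at the identity.\<close>

definition free_points :: "(nat \<Rightarrow> real) set" where
  "free_points = {y. inj y}"

lemma sets_free_points [measurable]: "free_points \<in> sets borel"
proof -
  have "free_points = {y \<in> space borel. \<forall>i j. y i = y j \<longrightarrow> i = j}" by (auto simp: free_points_def inj_def)
  also have "\<dots> = (\<Inter>i. \<Inter>j\<in>-{i}. {y \<in> space borel. y i \<noteq> y j})" by auto
  also have "\<dots> \<in> sets borel"
    by (intro sets.countable_INT'' borel_measurable_neq measurable_product_coordinates) auto
  finally show ?thesis .
qed

lemma AE_free_points: "AE y in bernoulli. y \<in> free_points"
proof -
  have "AE y in bernoulli. \<forall>i j. i \<noteq> j \<longrightarrow> y i \<noteq> y j"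
    unfolding AE_all_countable by (intro allI AE_impI AE_coordinates_distinct)
  then show ?thesis by eventually_elim (auto simp: free_points_def inj_def)
qed

context nat_group begin

lemma right_mul_cancel: "a \<cdot> g = b \<cdot> g \<Longrightarrow> a = b"
  by (metis mul_inv_cancel(1))

lemma act_free_points [simp]: "act g y \<in> free_points \<longleftrightarrow> y \<in> free_points"
proof -
  have "inj (act g y)" if "inj y" for g and y :: "nat \<Rightarrow> real"
    using that unfolding inj_def act_def by (metis mul_inv_cancel(1))
  then show ?thesis unfolding free_points_def by (metis act_inv(2) mem_Collect_eq)
qed

lemma act_measurable [measurable]: "act g \<in> borel_measurable (borel :: (nat \<Rightarrow> 'a::second_countable_topology) measure)"
  by (rule measurable_coordinatewise_then_product) (simp add: act_def)

lemma act_measure_preserving: "distr bernoulli bernoulli (act g) = bernoulli"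
proof -
  have "distr (PiM UNIV (\<lambda>_. unif)) (PiM UNIV (\<lambda>_. unif)) (\<lambda>y. \<lambda>d\<in>UNIV. y (d \<cdot> g)) = PiM UNIV (\<lambda>_. unif)"
    by (rule distr_PiM_reindex) (auto simp: prob_space_unif inj_def intro: right_mul_cancel)
  moreover have "(\<lambda>y::nat \<Rightarrow> real. \<lambda>d\<in>UNIV. y (d \<cdot> g)) = act g" by (simp add: act_def fun_eq_iff)
  ultimately show ?thesis by (simp only: bernoulli_def)
qed

lemma measure_act: "A \<in> sets borel \<Longrightarrow> measure bernoulli (act g -` A) = measure bernoulli A"
  using measure_distr[of "act g" bernoulli bernoulli A] by (simp add: act_measure_preserving)

text \<open>Since the group is the set of natural numbers, leaving every finite subset of the group amounts to
  tending to infinity along \<open>sequentially\<close>.\<close>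

definition mixing :: "(nat \<Rightarrow> real) set \<Rightarrow> (nat \<Rightarrow> real) set \<Rightarrow> bool" where
  "mixing A B \<longleftrightarrow> (\<lambda>g. measure bernoulli (A \<inter> act g -` B)) \<longlonglongrightarrow> measure bernoulli A * measure bernoulli B"

lemma sets_act_vimage: "A \<in> sets borel \<Longrightarrow> act g -` A \<in> sets (borel :: (nat \<Rightarrow> real) measure)"
  using measurable_sets_borel[OF act_measurable] .

text \<open>As soon as the translate of the window \<open>K\<close> is disjoint from \<open>J\<close>, the two events are independent.\<close>

lemma mixing_box:
  assumes J: "finite J" "\<And>j. j \<in> J \<Longrightarrow> E j \<in> sets borel"
    and K: "finite K" "\<And>k. k \<in> K \<Longrightarrow> F k \<in> sets borel"
  shows "mixing {y. \<forall>j\<in>J. y j \<in> E j} {y. \<forall>k\<in>K. y k \<in> F k}" (is "mixing ?A ?B")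
proof -
  let ?bad = "setmul (ginv ` K) J"
  have "finite ?bad" using J K by simp
  then obtain m where m: "?bad \<subseteq> {..<m}" unfolding finite_nat_iff_bounded by blast
  have "measure bernoulli (?A \<inter> act g -` ?B) = measure bernoulli ?A * measure bernoulli ?B" if g: "g \<ge> m" for g
  proof -
    define f where "f = (\<lambda>k. k \<cdot> g)"
    have inj: "inj_on f K" by (auto simp: f_def inj_on_def intro: right_mul_cancel)
    have disj: "J \<inter> f ` K = {}"
    proof (rule ccontr)
      assume "J \<inter> f ` K \<noteq> {}"
      then obtain k where k: "k \<in> K" "k \<cdot> g \<in> J" by (auto simp: f_def)
      then have "ginv k \<cdot> (k \<cdot> g) \<in> ?bad" by (intro setmulI imageI)
      then show False using m g by auto
    qed
    define H where "H = (\<lambda>i. if i \<in> J then E i else F (i \<cdot> ginv g))"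
    have H: "H j = E j" if "j \<in> J" for j using that by (simp add: H_def)
    have H': "H (f k) = F k" if "k \<in> K" for k
      using that disj by (auto simp: H_def f_def)
    have "?A \<inter> act g -` ?B = {y. \<forall>i\<in>J \<union> f ` K. y i \<in> H i}"
      using H H' by (auto simp: act_def f_def ball_Un)
    also have "measure bernoulli \<dots> = (\<Prod>i\<in>J \<union> f ` K. measure unif (H i))"
      using H H' J K by (intro measure_box) auto
    also have "\<dots> = (\<Prod>j\<in>J. measure unif (H j)) * (\<Prod>k\<in>K. measure unif (H (f k)))"
      using J(1) K(1) disj inj by (simp add: prod.union_disjoint prod.reindex)
    also have "\<dots> = (\<Prod>j\<in>J. measure unif (E j)) * (\<Prod>k\<in>K. measure unif (F k))"
      using H H' by simp
    also have "\<dots> = measure bernoulli ?A * measure bernoulli ?B"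
      using J K by (simp add: measure_box)
    finally show ?thesis .
  qed
  then have "eventually (\<lambda>g. measure bernoulli (?A \<inter> act g -` ?B) = measure bernoulli ?A * measure bernoulli ?B) sequentially"
    unfolding eventually_sequentially by blast
  then show ?thesis unfolding mixing_def by (rule tendsto_eventually)
qed

lemma measure_disjoint_UN:
  fixes A :: "nat \<Rightarrow> (nat \<Rightarrow> real) set"
  assumes "\<And>i. A i \<in> sets borel" "disjoint_family A"
  shows "measure bernoulli (\<Union>i. A i) = (\<Sum>i. measure bernoulli (A i))" "summable (\<lambda>i. measure bernoulli (A i))"
proof -
  have "range A \<subseteq> sets bernoulli" using assms(1) by auto
  then have "(\<lambda>i. measure bernoulli (A i)) sums measure bernoulli (\<Union>i. A i)"
    using assms(2) by (rule B.finite_measure_UNION)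
  then show "measure bernoulli (\<Union>i. A i) = (\<Sum>i. measure bernoulli (A i))" "summable (\<lambda>i. measure bernoulli (A i))"
    by (simp_all add: sums_iff)
qed

text \<open>The class of sets satisfying the mixing relation is a Dynkin system in either argument; the exchange
  of limit and sum is Tannery's theorem, with the measures of the summands as dominating sequence.\<close>

lemma mixing_UN_left:
  assumes A: "\<And>i::nat. A i \<in> sets borel" "disjoint_family A" and B: "B \<in> sets borel"
    and mix: "\<And>i. mixing (A i) B"
  shows "mixing (\<Union>i. A i) B"
proof -
  have "((\<lambda>g. \<Sum>i. measure bernoulli (A i \<inter> act g -` B)) \<longlongrightarrow> (\<Sum>i. measure bernoulli (A i) * measure bernoulli B)) sequentially"
  proof (rule tannerys_theorem[THEN conjunct2, THEN conjunct2])
    show "(\<lambda>g. measure bernoulli (A i \<inter> act g -` B)) \<longlonglongrightarrow> measure bernoulli (A i) * measure bernoulli B" for i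
      using mix[of i] by (simp add: mixing_def)
    show "eventually (\<lambda>(i, g). norm (measure bernoulli (A i \<inter> act g -` B)) \<le> measure bernoulli (A i)) (at_top \<times>\<^sub>F sequentially)"
      using A by (auto intro!: always_eventually B.finite_measure_mono)
  qed (use measure_disjoint_UN(2)[OF A] in auto)
  moreover have "(\<Sum>i. measure bernoulli (A i \<inter> act g -` B)) = measure bernoulli ((\<Union>i. A i) \<inter> act g -` B)" for g
    using A B sets_act_vimage[OF B, of g]
    by (subst measure_disjoint_UN(1)[symmetric]) (auto simp: disjoint_family_on_def)
  moreover have "(\<Sum>i. measure bernoulli (A i) * measure bernoulli B) = measure bernoulli (\<Union>i. A i) * measure bernoulli B"
    by (simp add: measure_disjoint_UN[OF A] suminf_mult2)
  ultimately show ?thesis by (simp add: mixing_def)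
qed

lemma mixing_UN_right:
  assumes A: "A \<in> sets borel" and B: "\<And>i::nat. B i \<in> sets borel" "disjoint_family B"
    and mix: "\<And>i. mixing A (B i)"
  shows "mixing A (\<Union>i. B i)"
proof -
  have "((\<lambda>g. \<Sum>i. measure bernoulli (A \<inter> act g -` B i)) \<longlongrightarrow> (\<Sum>i. measure bernoulli A * measure bernoulli (B i))) sequentially"
  proof (rule tannerys_theorem[THEN conjunct2, THEN conjunct2])
    show "(\<lambda>g. measure bernoulli (A \<inter> act g -` B i)) \<longlonglongrightarrow> measure bernoulli A * measure bernoulli (B i)" for i
      using mix[of i] by (simp add: mixing_def)
    have "measure bernoulli (A \<inter> act g -` B i) \<le> measure bernoulli (B i)" for g i
      using B.finite_measure_mono[of "A \<inter> act g -` B i" "act g -` B i"] sets_act_vimage[OF B(1), of g i]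
      by (simp add: measure_act B(1))
    then show "eventually (\<lambda>(i, g). norm (measure bernoulli (A \<inter> act g -` B i)) \<le> measure bernoulli (B i)) (at_top \<times>\<^sub>F sequentially)"
      by (auto intro!: always_eventually)
  qed (use measure_disjoint_UN(2)[OF B] in auto)
  moreover have "(\<Sum>i. measure bernoulli (A \<inter> act g -` B i)) = measure bernoulli (A \<inter> act g -` (\<Union>i. B i))" for g
  proof -
    have eq: "A \<inter> act g -` (\<Union>i. B i) = (\<Union>i. A \<inter> act g -` B i)" by auto
    show ?thesis
      unfolding eq
    proof (rule measure_disjoint_UN(1)[symmetric])
      show "A \<inter> act g -` B i \<in> sets borel" for i using A sets_act_vimage[OF B(1)] by (rule sets.Int)
      show "disjoint_family (\<lambda>i. A \<inter> act g -` B i)" using B(2) by (auto simp: disjoint_family_on_def)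
    qed
  qed
  moreover have "(\<Sum>i. measure bernoulli A * measure bernoulli (B i)) = measure bernoulli A * measure bernoulli (\<Union>i. B i)"
    by (simp add: measure_disjoint_UN[OF B] suminf_mult)
  ultimately show ?thesis by (simp add: mixing_def)
qed

lemma mixing_compl_left:
  assumes A: "A \<in> sets borel" and B: "B \<in> sets borel" and mix: "mixing A B"
  shows "mixing (UNIV - A) B"
proof -
  have "measure bernoulli ((UNIV - A) \<inter> act g -` B) = measure bernoulli B - measure bernoulli (A \<inter> act g -` B)" for g
  proof -
    have "(UNIV - A) \<inter> act g -` B = act g -` B - A \<inter> act g -` B" by auto
    then show ?thesis
      using A B sets_act_vimage[OF B, of g] by (simp add: B.finite_measure_Diff measure_act)
  qed
  moreover have "measure bernoulli (UNIV - A) = 1 - measure bernoulli A"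
    using B.prob_compl[of A] A by simp
  moreover have "(\<lambda>g. measure bernoulli B - measure bernoulli (A \<inter> act g -` B)) \<longlonglongrightarrow>
      measure bernoulli B - measure bernoulli A * measure bernoulli B"
    using mix by (intro tendsto_intros) (simp add: mixing_def)
  ultimately show ?thesis by (simp add: mixing_def left_diff_distrib)
qed

lemma mixing_compl_right:
  assumes A: "A \<in> sets borel" and B: "B \<in> sets borel" and mix: "mixing A B"
  shows "mixing A (UNIV - B)"
proof -
  have "measure bernoulli (A \<inter> act g -` (UNIV - B)) = measure bernoulli A - measure bernoulli (A \<inter> act g -` B)" for g
  proof -
    have "A \<inter> act g -` (UNIV - B) = A - A \<inter> act g -` B" by auto
    then show ?thesis
      using A sets_act_vimage[OF B, of g] by (simp add: B.finite_measure_Diff)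
  qed
  moreover have "measure bernoulli (UNIV - B) = 1 - measure bernoulli B"
    using B.prob_compl[of B] B by simp
  moreover have "(\<lambda>g. measure bernoulli A - measure bernoulli (A \<inter> act g -` B)) \<longlonglongrightarrow>
      measure bernoulli A - measure bernoulli A * measure bernoulli B"
    using mix by (intro tendsto_intros) (simp add: mixing_def)
  ultimately show ?thesis by (simp add: mixing_def right_diff_distrib)
qed

lemma boxes_generate:
  "sets (borel :: (nat \<Rightarrow> real) measure) = sigma_sets UNIV (prod_algebra UNIV (\<lambda>_. unif))"
  using sets_PiM[of UNIV "\<lambda>_::nat. unif"] by (simp add: bernoulli_def[symmetric])

lemma prod_algebra_box:
  assumes "A \<in> prod_algebra UNIV (\<lambda>_. unif)"
  obtains J E where "finite J" "\<And>j. j \<in> J \<Longrightarrow> E j \<in> sets borel" "A = {y. \<forall>j\<in>J. y j \<in> E j}"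
  using assms by (elim prod_algebraE) (auto simp: emb_eq_box)

lemma bernoulli_mixing:
  assumes A: "A \<in> sets borel" and B: "B \<in> sets borel"
  shows "mixing A B"
proof -
  have box: "mixing A B" if A: "A \<in> prod_algebra UNIV (\<lambda>_. unif)" and B: "B \<in> sets borel" for A B
  proof -
    have A': "A \<in> sets borel" using A unfolding boxes_generate by blast
    have "B \<in> sigma_sets UNIV (prod_algebra UNIV (\<lambda>_. unif))" using B unfolding boxes_generate .
    then show ?thesis
    proof (induction rule: sigma_sets_induct_disjoint[OF Int_stable_prod_algebra eq_refl[OF Pow_UNIV[symmetric], THEN subset_trans[OF subset_UNIV]], consumes 1, case_names basic empty compl union])
      case (basic B)
      then show ?case using A by (elim prod_algebra_box) (auto intro: mixing_box)
    next
      case empty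
      then show ?case by (simp add: mixing_def)
    next
      case (compl B)
      then show ?case using mixing_compl_right[OF A'] by (simp add: boxes_generate)
    next
      case (union B)
      show ?case by (rule mixing_UN_right[OF A']) (use union in \<open>auto simp: boxes_generate\<close>)
    qed
  qed
  have "A \<in> sigma_sets UNIV (prod_algebra UNIV (\<lambda>_. unif))" using A unfolding boxes_generate .
  then show ?thesis
  proof (induction rule: sigma_sets_induct_disjoint[OF Int_stable_prod_algebra eq_refl[OF Pow_UNIV[symmetric], THEN subset_trans[OF subset_UNIV]], consumes 1, case_names basic empty compl union])
    case (basic A)
    then show ?case using B by (rule box)
  next
    case empty
    then show ?case by (simp add: mixing_def)
  next
    case (compl A)
    then show ?case using mixing_compl_left[OF _ B] by (simp add: boxes_generate)
  next
    case (union A)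
    show ?case by (rule mixing_UN_left[OF _ _ B]) (use union in \<open>auto simp: boxes_generate\<close>)
  qed
qed

text \<open>For an invariant set the mixing relation reads \<open>\<mu> A = (\<mu> A)\<^sup>2\<close>.\<close>

lemma bernoulli_ergodic:
  assumes A: "A \<in> sets borel" and inv: "\<And>g. act g -` A = A"
  shows "measure bernoulli A = 0 \<or> measure bernoulli A = 1"
proof -
  have "(\<lambda>g::nat. measure bernoulli A) \<longlonglongrightarrow> measure bernoulli A * measure bernoulli A"
    using bernoulli_mixing[OF A A] by (simp add: mixing_def inv)
  then have "measure bernoulli A = measure bernoulli A * measure bernoulli A"
    by (simp add: LIMSEQ_const_iff)
  then show ?thesis by simp
qed

text \<open>A point is coloured by the integer part of \<open>n y\<^sub>1\<close>, where \<open>n\<close> is so large that \<open>n y\<^sub>1\<close> and \<open>n y\<^sub>s\<close>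
  have different integer parts for all \<open>s \<in> S\<close>. Recording \<open>n\<close> as part of the colour ensures that points
  of equal colour are compared at the same scale.\<close>

lemma separated_colouring:
  assumes S: "finite S" "one \<notin> S"
  shows "\<exists>c :: (nat \<Rightarrow> real) \<Rightarrow> nat. c \<in> measurable borel (count_space UNIV) \<and>
    (\<forall>y\<in>free_points. \<forall>s\<in>S. c (act s y) \<noteq> c y)"
proof -
  define P where "P = (\<lambda>(y::nat \<Rightarrow> real) (n::nat). \<forall>s\<in>S. \<lfloor>real n * y s\<rfloor> \<noteq> \<lfloor>real n * y one\<rfloor>)"
  define n where "n = (\<lambda>y. LEAST n. P y n)"
  define c where "c = (\<lambda>y. to_nat (n y, \<lfloor>real (n y) * y one\<rfloor>))"
  have n_P: "P y (n y)" if y: "y \<in> free_points" for y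
    unfolding n_def
  proof (rule LeastI_ex)
    have "\<exists>m. \<forall>n\<ge>m. \<lfloor>real n * y s\<rfloor> \<noteq> \<lfloor>real n * y one\<rfloor>" if s: "s \<in> S" for s
    proof -
      have "s \<noteq> one" using s S(2) by auto
      then have ne: "\<bar>y s - y one\<bar> > 0" using y by (auto simp: free_points_def inj_def)
      obtain m where m: "1 < real m * \<bar>y s - y one\<bar>" using reals_Archimedean3[OF ne] by blast
      have "\<lfloor>real n * y s\<rfloor> \<noteq> \<lfloor>real n * y one\<rfloor>" if "n \<ge> m" for n
      proof
        assume eq: "\<lfloor>real n * y s\<rfloor> = \<lfloor>real n * y one\<rfloor>"
        have "real m * \<bar>y s - y one\<bar> \<le> real n * \<bar>y s - y one\<bar>" using that by (intro mult_right_mono) auto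
        also have "\<dots> = \<bar>real n * y s - real n * y one\<bar>" by (simp add: abs_mult flip: right_diff_distrib)
        also have "\<dots> < 1" using eq by linarith
        finally show False using m by simp
      qed
      then show ?thesis by blast
    qed
    then obtain m where "\<And>s n. s \<in> S \<Longrightarrow> n \<ge> m s \<Longrightarrow> \<lfloor>real n * y s\<rfloor> \<noteq> \<lfloor>real n * y one\<rfloor>" by metis
    moreover have "m s \<le> (\<Sum>s\<in>S. m s)" if "s \<in> S" for s using that S(1) by (intro member_le_sum) auto
    ultimately show "\<exists>n. P y n" unfolding P_def by blast
  qed
  have coord: "(\<lambda>y. y i) \<in> borel_measurable (borel :: (nat \<Rightarrow> real) measure)" for i
    by (rule measurable_product_coordinates)
  have fl: "(\<lambda>y. \<lfloor>real n * y i\<rfloor>) \<in> measurable (borel :: (nat \<Rightarrow> real) measure) (count_space UNIV)" for n i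
    using measurable_compose[OF borel_measurable_times[OF borel_measurable_const coord] measurable_real_floor] .
  have P_meas: "(\<lambda>y. P y n) \<in> measurable borel (count_space UNIV)" for n
  proof -
    have "Measurable.pred borel (\<lambda>y::nat \<Rightarrow> real. \<lfloor>real n * y s\<rfloor> \<noteq> \<lfloor>real n * y one\<rfloor>)" for s
      by (rule measurable_compose_countable[OF _ fl[of n s]], rule measurable_compose[OF fl[of n one]]) simp
    then show ?thesis unfolding P_def using S(1) by (intro pred_intros_finite)
  qed
  have n_meas: "n \<in> measurable borel (count_space UNIV)"
    unfolding n_def by (rule measurable_Least[OF P_meas])
  have c_meas: "c \<in> measurable borel (count_space UNIV)"
    unfolding c_def
  proof (rule measurable_compose_countable[OF _ n_meas])
    show "(\<lambda>y. to_nat (i, \<lfloor>real i * y one\<rfloor>)) \<in> measurable borel (count_space UNIV)" for i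
      by (rule measurable_compose[OF fl]) simp
  qed
  have "c (act s y) \<noteq> c y" if "y \<in> free_points" "s \<in> S" for y s
  proof
    assume "c (act s y) = c y"
    then have n: "n (act s y) = n y" and "\<lfloor>real (n (act s y)) * act s y one\<rfloor> = \<lfloor>real (n y) * y one\<rfloor>"
      by (auto simp: c_def)
    then have "\<lfloor>real (n y) * y s\<rfloor> = \<lfloor>real (n y) * y one\<rfloor>" by (simp add: act_def)
    with n_P[OF that(1)] that(2) show False by (simp add: P_def)
  qed
  with c_meas show ?thesis by blast
qed

end

section \<open>Measurable planting of a pattern\<close>

lemma tendsto_funI:
  fixes x :: "'a \<Rightarrow> 'i \<Rightarrow> 'b::topological_space"
  assumes "\<And>i. ((\<lambda>n. x n i) \<longlongrightarrow> l i) F"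
  shows "(x \<longlongrightarrow> l) F"
proof -
  have "limitin (product_topology (\<lambda>_. euclidean) UNIV) x l F"
    using assms by (simp add: limitin_componentwise)
  then show ?thesis by (simp add: euclidean_product_topology)
qed

text \<open>This makes the Borel sets of the Cantor set, and of the space of configurations, the product
  sigma-algebra.\<close>

instance bool :: second_countable_topology
proof
  have "open = generate_topology (UNIV :: bool set set)"
    by (auto simp: fun_eq_iff open_discrete intro: generate_topology.Basis)
  then show "\<exists>B::bool set set. countable B \<and> open = generate_topology B"
    by (intro exI[of _ UNIV]) (simp add: countable_finite)
qed

lemma borel_measurable_configI:
  fixes f :: "'a \<Rightarrow> config"
  assumes "\<And>d c. (\<lambda>x. f x d c) \<in> borel_measurable M"
  shows "f \<in> borel_measurable M"
  by (intro measurable_coordinatewise_then_product assms)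

text \<open>An enumeration of all finite patterns: bit sets of natural numbers, read through the pairing function.\<close>

definition pat :: "nat \<Rightarrow> config" where
  "pat i d c \<longleftrightarrow> prod_encode (d, c) \<in> set_decode i"

lemma pat_surj:
  assumes "finite D"
  obtains i where "\<And>d c. d \<in> D \<Longrightarrow> c < N \<Longrightarrow> pat i d c = x d c"
proof -
  let ?A = "{prod_encode (d, c) |d c. d \<in> D \<and> c < N \<and> x d c}"
  have "?A \<subseteq> prod_encode ` (D \<times> {..<N})" by auto
  then have "finite ?A" by (rule finite_subset) (use assms in simp)
  then have "set_decode (set_encode ?A) = ?A" by (rule set_encode_inverse)
  then show ?thesis by (intro that[of "set_encode ?A"]) (auto simp: pat_def)
qed

context nat_group begin

text \<open>The itinerary of a point, read through a labelling of the points. It depends equivariantly on the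
  point, whatever the labelling (\<open>cfg_act\<close>).\<close>

definition cfg :: "((nat \<Rightarrow> real) \<Rightarrow> nat \<Rightarrow> bool) \<Rightarrow> (nat \<Rightarrow> real) \<Rightarrow> config" where
  "cfg f y g = f (act g y)"

lemma cfg_act: "cfg f (act g y) = act g (cfg f y)"
proof (rule ext)
  show "cfg f (act g y) d = act g (cfg f y) d" for d
    by (simp only: cfg_def act_act act_def[of g "cfg f y"])
qed

lemma cfg_measurable:
  assumes "f \<in> borel_measurable borel"
  shows "cfg f \<in> borel_measurable borel"
  by (rule measurable_coordinatewise_then_product)
    (simp add: cfg_def measurable_compose[OF act_measurable assms])

definition labels :: "config set \<Rightarrow> ((nat \<Rightarrow> real) \<Rightarrow> nat \<Rightarrow> bool) \<Rightarrow> bool" where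
  "labels P f \<longleftrightarrow> f \<in> borel_measurable borel \<and> (\<forall>y\<in>free_points. cfg f y \<in> P)"

end

context pattern_step begin

text \<open>Only finitely many fillings of \<open>D\<close> matter, and all of them are among the numbered patterns. Taking the
  first one that works turns the existence of a repair into a Borel function of the configuration.\<close>

definition override :: "config \<Rightarrow> nat \<Rightarrow> config" where
  "override x i = (\<lambda>d c. if d \<in> D \<and> c < N' then pat i d c else x d c)"

definition repair :: "config \<Rightarrow> config" where
  "repair x = override x (LEAST i. override x i \<in> P \<and> occurs (override x i))"

lemma repair:
  assumes "x \<in> P"
  shows "repair x \<in> P" "occurs (repair x)" "d \<notin> D \<or> c \<ge> N' \<Longrightarrow> repair x d c = x d c"
proof -
  obtain u where u: "u \<in> P" "occurs u" "agree_off D N' u x"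
    using repairable[OF assms] by (auto simp: occurs_def)
  obtain i where i: "\<And>d c. d \<in> D \<Longrightarrow> c < N' \<Longrightarrow> pat i d c = u d c" using pat_surj[OF fin_D] by blast
  have "override x i = u" using i u(3) by (auto simp: override_def agree_off_def fun_eq_iff not_less)
  then have "override x i \<in> P \<and> occurs (override x i)" using u by simp
  then have "repair x \<in> P \<and> occurs (repair x)" unfolding repair_def by (rule LeastI)
  then show "repair x \<in> P" "occurs (repair x)" by auto
  show "repair x d c = x d c" if "d \<notin> D \<or> c \<ge> N'" using that by (auto simp: repair_def override_def)
qed

lemma config_coordinate_measurable: "(\<lambda>x::config. x d c) \<in> borel_measurable borel"
  by (intro borel_measurable_continuous_onI continuous_on_config_coordinate)

lemma override_measurable: "(\<lambda>x. override x i) \<in> borel_measurable borel"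
proof (rule borel_measurable_configI)
  fix d c
  show "(\<lambda>x. override x i d c) \<in> borel_measurable borel"
  proof (cases "d \<in> D \<and> c < N'")
    case True
    then have "(\<lambda>x. override x i d c) = (\<lambda>x. pat i d c)" by (simp add: override_def)
    then show ?thesis by (simp only: borel_measurable_const)
  next
    case False
    then have "(\<lambda>x. override x i d c) = (\<lambda>x. x d c)" by (auto simp: override_def)
    then show ?thesis by (simp only: config_coordinate_measurable)
  qed
qed

lemma closed_occurs: "closed {x. occurs x}"
proof -
  have "{x. occurs x} = (\<Inter>w\<in>W. \<Inter>c\<in>{..<N}. {x. x w c = p w c})"
    by (auto simp: occurs_def agree_def)
  also have "closed \<dots>" by (intro closed_INT ballI closed_config_coordinate)
  finally show ?thesis .
qed

lemma repair_measurable: "repair \<in> borel_measurable borel"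
  unfolding repair_def
proof (rule measurable_compose_countable[OF override_measurable], rule measurable_Least)
  fix i
  have "(\<lambda>x. override x i) -` (P \<inter> {x. occurs x}) \<in> sets borel"
    by (intro measurable_sets_borel[OF override_measurable] borel_closed closed_Int closed_occurs flexibleD(1)[OF flex])
  then show "Measurable.pred borel (\<lambda>x. override x i \<in> P \<and> occurs (override x i))"
    by (simp add: Measurable.pred_def vimage_def)
qed

definition hit :: "(nat \<Rightarrow> real) set \<Rightarrow> (nat \<Rightarrow> real) \<Rightarrow> nat \<Rightarrow> bool" where
  "hit Z u d \<longleftrightarrow> d \<in> D \<and> act (ginv d) u \<in> Z"

text \<open>Plant the pattern at all points of \<open>Z\<close> simultaneously. The point \<open>u\<close> is affected by the centre
  \<open>d\<^sup>-\<^sup>1 u\<close>; the centres will be so sparse that there is at most one, so taking the least \<open>d\<close> only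
  serves to make the function well-defined everywhere.\<close>

definition patch :: "(nat \<Rightarrow> real) set \<Rightarrow> ((nat \<Rightarrow> real) \<Rightarrow> nat \<Rightarrow> bool) \<Rightarrow> (nat \<Rightarrow> real) \<Rightarrow> nat \<Rightarrow> bool" where
  "patch Z f u = (if \<exists>d. hit Z u d
     then repair (cfg f (act (ginv (LEAST d. hit Z u d)) u)) (LEAST d. hit Z u d) else f u)"

lemma patch_measurable:
  assumes Z: "Z \<in> sets borel" and f: "f \<in> borel_measurable borel"
  shows "patch Z f \<in> borel_measurable borel"
proof -
  have hit: "Measurable.pred borel (\<lambda>u. hit Z u d)" for d
  proof (cases "d \<in> D")
    case True
    then show ?thesis
      using sets_act_vimage[OF Z, of "ginv d"] by (simp add: hit_def Measurable.pred_def vimage_def)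
  qed (simp add: hit_def)
  have "(\<lambda>u. repair (cfg f (act (ginv d) u)) d) \<in> borel_measurable borel" for d
    using measurable_compose[OF measurable_compose[OF act_measurable cfg_measurable[OF f]] repair_measurable]
    by (rule measurable_product_then_coordinatewise)
  then have "(\<lambda>u. repair (cfg f (act (ginv (LEAST d. hit Z u d)) u)) (LEAST d. hit Z u d)) \<in> borel_measurable borel"
    by (rule measurable_compose_countable[OF _ measurable_Least[OF hit]])
  moreover have "{u \<in> space borel. \<exists>d. hit Z u d} \<in> sets borel"
    using hit by (intro sets.sets_Collect_countable_Ex) (simp add: Measurable.pred_def)
  ultimately have "(\<lambda>u. if \<exists>d. hit Z u d
     then repair (cfg f (act (ginv (LEAST d. hit Z u d)) u)) (LEAST d. hit Z u d) else f u) \<in> borel_measurable borel"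
    using f by (intro measurable_If)
  then show ?thesis by (simp only: patch_def[abs_def])
qed

end

text \<open>The separation is by \<open>D\<^sup>-\<^sup>1 E E\<^sup>-\<^sup>1 D\<close>, so that every window \<open>E y\<close> meets at most one planted region. Then
  each window looks like one in which a single pattern has been planted, and locality applies.\<close>

locale separated_patch = pattern_step +
  fixes E :: "nat set" and Z :: "(nat \<Rightarrow> real) set" and f :: "(nat \<Rightarrow> real) \<Rightarrow> nat \<Rightarrow> bool"
  assumes one_E: "one \<in> E"
    and local_E: "\<And>u. \<exists>x\<in>P. \<forall>d. \<forall>c\<ge>N'. u d c = x d c \<Longrightarrow>
      \<forall>g. \<exists>x\<in>P. \<forall>e\<in>E. u (e \<cdot> g) = x (e \<cdot> g) \<Longrightarrow> u \<in> P"
    and Z_sets: "Z \<in> sets borel" and Z_free: "Z \<subseteq> free_points"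
    and Z_separated: "\<And>z s. z \<in> Z \<Longrightarrow> s \<in> setmul (setmul (ginv ` D) E) (setmul (ginv ` E) D) \<Longrightarrow>
      act s z \<in> Z \<Longrightarrow> s = one"
    and labels: "labels P f"
begin

lemma cfg_P: "y \<in> free_points \<Longrightarrow> cfg f y \<in> P"
  using labels by (simp add: labels_def)

lemma patch_off: "(\<And>d. \<not> hit Z u d) \<Longrightarrow> patch Z f u = f u"
  by (simp add: patch_def)

text \<open>If the window \<open>E y\<close> meets the region planted at \<open>z\<close>, say \<open>e' y = d z\<close>, then its points are
  \<open>e e'\<^sup>-\<^sup>1 d z\<close>. A centre other than \<open>z\<close> affecting one of them would be too close to \<open>z\<close>.\<close>

lemma patch_window:
  assumes z: "z \<in> Z" and d: "d \<in> D" and e: "e \<in> E" "e' \<in> E"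
  shows "patch Z f (act (e \<cdot> ginv e' \<cdot> d) z) = repair (cfg f z) (e \<cdot> ginv e' \<cdot> d)"
proof -
  define a where "a = e \<cdot> ginv e' \<cdot> d"
  have hit_iff: "hit Z (act a z) d' \<longleftrightarrow> d' = a" if d': "d' \<in> D" for d'
  proof
    assume "hit Z (act a z) d'"
    then have "act (ginv d' \<cdot> a) z \<in> Z" by (simp add: hit_def act_act)
    moreover have "ginv d' \<cdot> a = (ginv d' \<cdot> e) \<cdot> (ginv e' \<cdot> d)" by (simp add: a_def assoc)
    then have "ginv d' \<cdot> a \<in> setmul (setmul (ginv ` D) E) (setmul (ginv ` E) D)"
      using d d' e by (auto intro!: setmulI)
    ultimately have "ginv d' \<cdot> a = one" using Z_separated z by blast
    then show "d' = a" by (metis mul_inv_cancel(4) group_left_neutral mul_inv_cancel(1) right_inverse)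
  next
    assume "d' = a"
    then show "hit Z (act a z) d'" using d' z by (simp add: hit_def)
  qed
  show ?thesis
    unfolding a_def[symmetric]
  proof (cases "a \<in> D")
    case True
    then have "hit Z (act a z) = (\<lambda>d'. d' = a)" using hit_iff unfolding hit_def by blast
    moreover have "(LEAST d'. d' = a) = a" by (rule Least_equality) auto
    ultimately show "patch Z f (act a z) = repair (cfg f z) a" by (simp add: patch_def)
  next
    case False
    then have "\<not> hit Z (act a z) d'" for d' using hit_iff[of d'] unfolding hit_def by blast
    then have "patch Z f (act a z) = cfg f z a" by (simp add: patch_off cfg_def)
    also have "\<dots> = repair (cfg f z) a"
      using repair(3)[OF cfg_P] z Z_free False by (auto simp: fun_eq_iff)
    finally show "patch Z f (act a z) = repair (cfg f z) a" .
  qed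
qed

lemma patch_at: "z \<in> Z \<Longrightarrow> d \<in> D \<Longrightarrow> patch Z f (act d z) = repair (cfg f z) d"
  using patch_window[OF _ _ one_E one_E, of z d] by simp

lemma patch_coordinate:
  assumes "u \<in> free_points" "c \<ge> N'"
  shows "patch Z f u c = f u c"
proof (cases "\<exists>d. hit Z u d")
  case True
  then obtain d where d: "d \<in> D" "act (ginv d) u \<in> Z" by (auto simp: hit_def)
  have "patch Z f u c = repair (cfg f (act (ginv d) u)) d c" using patch_at[OF d(2,1)] by simp
  also have "\<dots> = cfg f (act (ginv d) u) d c" using assms by (intro repair(3) cfg_P) auto
  also have "\<dots> = f u c" by (simp add: cfg_def)
  finally show ?thesis .
qed (simp add: patch_off)

text \<open>A window meeting the region planted at \<open>z\<close> looks like a window of the repaired configuration of \<open>z\<close>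
  (\<open>patch_window\<close>); all other windows are unchanged.\<close>

lemma patch_labels: "labels P (patch Z f)"
  unfolding labels_def
proof (intro conjI ballI)
  show "patch Z f \<in> borel_measurable borel"
    using labels by (intro patch_measurable Z_sets) (simp add: labels_def)
  fix y assume y: "y \<in> free_points"
  show "cfg (patch Z f) y \<in> P"
  proof (rule local_E, rule bexI[OF _ cfg_P[OF y]])
    show "\<forall>d. \<forall>c\<ge>N'. cfg (patch Z f) y d c = cfg f y d c"
      using y by (simp add: cfg_def patch_coordinate)
    show "\<forall>g. \<exists>x\<in>P. \<forall>e\<in>E. cfg (patch Z f) y (e \<cdot> g) = x (e \<cdot> g)"
    proof
      fix g
      show "\<exists>x\<in>P. \<forall>e\<in>E. cfg (patch Z f) y (e \<cdot> g) = x (e \<cdot> g)"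
      proof (cases "\<exists>e\<in>E. \<exists>d. hit Z (act (e \<cdot> g) y) d")
        case True
        then obtain e' d where e': "e' \<in> E" "d \<in> D" "act (ginv d \<cdot> (e' \<cdot> g)) y \<in> Z"
          by (auto simp: hit_def act_act)
        define z where "z = act (ginv d \<cdot> (e' \<cdot> g)) y"
        have z: "z \<in> Z" "z \<in> free_points" using e'(3) Z_free by (auto simp: z_def)
        define x where "x = act (ginv (ginv d \<cdot> (e' \<cdot> g))) (repair (cfg f z))"
        have "x \<in> P" unfolding x_def by (intro flexibleD(2)[OF flex] repair(1) cfg_P z)
        moreover have "cfg (patch Z f) y (e \<cdot> g) = x (e \<cdot> g)" if "e \<in> E" for e
        proof -
          have 1: "e \<cdot> ginv e' \<cdot> d \<cdot> (ginv d \<cdot> (e' \<cdot> g)) = e \<cdot> g" by (simp add: assoc)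
          then have "cfg (patch Z f) y (e \<cdot> g) = patch Z f (act (e \<cdot> ginv e' \<cdot> d) z)"
            by (simp only: cfg_def z_def act_act)
          also have "\<dots> = repair (cfg f z) (e \<cdot> ginv e' \<cdot> d)"
            by (rule patch_window[OF z(1) e'(2) that e'(1)])
          also have "e \<cdot> ginv e' \<cdot> d = (e \<cdot> g) \<cdot> ginv (ginv d \<cdot> (e' \<cdot> g))"
            using 1 mul_eq_iff(2) by blast
          finally show ?thesis by (simp only: x_def act_def)
        qed
        ultimately show ?thesis by blast
      next
        case False
        then have "\<forall>e\<in>E. cfg (patch Z f) y (e \<cdot> g) = cfg f y (e \<cdot> g)"
          by (simp add: cfg_def patch_off)
        then show ?thesis using cfg_P[OF y] by blast
      qed
    qed
  qed
qed

lemma patch_occurs: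
  assumes "z \<in> Z"
  shows "occurs (cfg (patch Z f) z)"
proof -
  have "occurs (repair (cfg f z))" using assms Z_free by (intro repair(2) cfg_P) auto
  then show ?thesis
    using patch_at[OF assms] W_D by (auto simp: occurs_def agree_def cfg_def)
qed

lemma patch_persists:
  assumes bad: "\<And>z. z \<in> Z \<Longrightarrow> \<not> near (cfg f z)" and "occurs (cfg f y)"
  shows "occurs (cfg (patch Z f) y)"
proof -
  have "patch Z f (act w y) = f (act w y)" if w: "w \<in> W" for w
  proof (rule patch_off, rule notI)
    fix d assume "hit Z (act w y) d"
    then have d: "d \<in> D" "act (ginv d \<cdot> w) y \<in> Z" by (auto simp: hit_def act_act)
    have "act (ginv w \<cdot> d) (act (ginv d \<cdot> w) y) = y" by (simp add: act_act assoc)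
    then have "occurs (act (ginv w \<cdot> d) (cfg f (act (ginv d \<cdot> w) y)))"
      using assms(2) by (simp add: cfg_act[symmetric])
    then have "near (cfg f (act (ginv d \<cdot> w) y))"
      unfolding near_def using W_D_V[OF w d(1)] by blast
    with bad[OF d(2)] show False by contradiction
  qed
  then show ?thesis using assms(2) by (auto simp: occurs_def agree_def cfg_def)
qed

end

context pattern_step begin

definition bad_class :: "((nat \<Rightarrow> real) \<Rightarrow> nat) \<Rightarrow> ((nat \<Rightarrow> real) \<Rightarrow> nat \<Rightarrow> bool) \<Rightarrow> nat \<Rightarrow> (nat \<Rightarrow> real) set" where
  "bad_class c h i = {y \<in> free_points. c y = i \<and> \<not> near (cfg h y)}"

lemma bad_class_sets:
  assumes c: "c \<in> measurable borel (count_space UNIV)" and h: "h \<in> borel_measurable borel"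
  shows "bad_class c h i \<in> sets borel"
proof -
  have "bad_class c h i = free_points \<inter> (c -` {i} \<inter> space borel) \<inter> (space borel - cfg h -` {x. near x})"
    by (auto simp: bad_class_def)
  also have "\<dots> \<in> sets borel"
    by (intro sets.Int sets_free_points measurable_sets[OF c] sets.Diff sets.top
        measurable_sets_borel[OF cfg_measurable[OF h]] borel_closed closed_near) auto
  finally show ?thesis .
qed

primrec stage :: "((nat \<Rightarrow> real) \<Rightarrow> nat) \<Rightarrow> ((nat \<Rightarrow> real) \<Rightarrow> nat \<Rightarrow> bool) \<Rightarrow> nat \<Rightarrow> (nat \<Rightarrow> real) \<Rightarrow> nat \<Rightarrow> bool" where
  "stage c f 0 = f"
| "stage c f (Suc i) = patch (bad_class c (stage c f i) i) (stage c f i)"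

end

text \<open>Points of the same colour are far enough apart for simultaneous planting, and are not within \<open>V\<close> of
  each other. The colour classes are treated in turn, planting at the points which at that time see no
  occurrence within \<open>V\<close>.\<close>

locale sweep = pattern_step +
  fixes E :: "nat set" and c :: "(nat \<Rightarrow> real) \<Rightarrow> nat" and f :: "(nat \<Rightarrow> real) \<Rightarrow> nat \<Rightarrow> bool"
  assumes one_E: "one \<in> E"
    and local_E: "\<And>u. \<exists>x\<in>P. \<forall>d. \<forall>c\<ge>N'. u d c = x d c \<Longrightarrow>
      \<forall>g. \<exists>x\<in>P. \<forall>e\<in>E. u (e \<cdot> g) = x (e \<cdot> g) \<Longrightarrow> u \<in> P"
    and c_measurable: "c \<in> measurable borel (count_space UNIV)"
    and c_separated: "\<And>y s. y \<in> free_points \<Longrightarrow>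
      s \<in> setmul (setmul (ginv ` D) E) (setmul (ginv ` E) D) \<union> V \<Longrightarrow> s \<noteq> one \<Longrightarrow> c (act s y) \<noteq> c y"
    and labels: "labels P f"
begin

abbreviation "F \<equiv> stage c f"
abbreviation "Z i \<equiv> bad_class c (F i) i"

lemma stage_separated_patch:
  "labels P (F i) \<Longrightarrow> separated_patch mul one ginv P p W N D N' V E (Z i) (F i)"
proof unfold_locales
  assume F: "labels P (F i)"
  show "Z i \<in> sets borel" using F by (intro bad_class_sets c_measurable) (simp add: labels_def)
  show "Z i \<subseteq> free_points" by (auto simp: bad_class_def)
  show "s = one" if "z \<in> Z i" "s \<in> setmul (setmul (ginv ` D) E) (setmul (ginv ` E) D)" "act s z \<in> Z i" for z s
    using that c_separated[of z s] by (auto simp: bad_class_def)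
qed (use one_E local_E in auto)

lemma stage_labels: "labels P (F i)"
proof (induction i)
  case (Suc i)
  then interpret separated_patch mul one ginv P p W N D N' V E "Z i" "F i" by (rule stage_separated_patch)
  show ?case using patch_labels by simp
qed (simp add: labels)

sublocale stage: separated_patch mul one ginv P p W N D N' V E "Z i" "F i" for i
  by (rule stage_separated_patch[OF stage_labels])

lemma stage_persists: "occurs (cfg (F i) y) \<Longrightarrow> i \<le> j \<Longrightarrow> occurs (cfg (F j) y)"
proof (induction j)
  case (Suc j)
  show ?case
  proof (cases "i = Suc j")
    case False
    then have "occurs (cfg (F j) y)" using Suc by simp
    then show ?thesis using stage.patch_persists[of j y] by (auto simp: bad_class_def)
  qed (use Suc in simp)
qed simp

lemma stage_occurs: "z \<in> Z i \<Longrightarrow> i < j \<Longrightarrow> occurs (cfg (F j) z)"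
  by (rule stage_persists[of "Suc i"]) (use stage.patch_occurs[of z i] in simp_all)

text \<open>A point is altered only by centres among the finitely many points \<open>d\<^sup>-\<^sup>1 u\<close>, hence not after the
  colours of all of these have been treated.\<close>

definition settled :: "(nat \<Rightarrow> real) \<Rightarrow> nat" where
  "settled u = (LEAST k. \<forall>d\<in>D. c (act (ginv d) u) < k)"

lemma settled: "d \<in> D \<Longrightarrow> c (act (ginv d) u) < settled u"
proof -
  have "\<exists>k. (\<lambda>d. c (act (ginv d) u)) ` D \<subseteq> {..<k}"
    using fin_D finite_nat_iff_bounded by blast
  then have "\<exists>k. \<forall>d\<in>D. c (act (ginv d) u) < k" by auto
  then have "\<forall>d\<in>D. c (act (ginv d) u) < settled u" unfolding settled_def by (rule LeastI_ex)
  then show "d \<in> D \<Longrightarrow> c (act (ginv d) u) < settled u" by blast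
qed

lemma stage_settled: "settled u \<le> i \<Longrightarrow> F i u = F (settled u) u"
proof (induction i)
  case (Suc i)
  show ?case
  proof (cases "settled u = Suc i")
    case False
    then have le: "settled u \<le> i" using Suc.prems by simp
    have "\<not> hit (Z i) u d" for d
    proof
      assume "hit (Z i) u d"
      then have d: "d \<in> D" "c (act (ginv d) u) = i" by (auto simp: hit_def bad_class_def)
      show False using settled[OF d(1), of u] d(2) le by simp
    qed
    then have "F (Suc i) u = F i u" by (simp add: patch_def)
    then show ?thesis using Suc.IH le by simp
  qed simp
qed simp

definition swept :: "(nat \<Rightarrow> real) \<Rightarrow> nat \<Rightarrow> bool" where
  "swept u = F (settled u) u"

lemma settled_measurable: "settled \<in> measurable borel (count_space UNIV)"
proof -
  have "Measurable.pred borel (\<lambda>u. c (act (ginv d) u) < k)" for d k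
    using measurable_compose[OF measurable_compose[OF act_measurable c_measurable], of "\<lambda>i. i < k" "count_space UNIV"]
    by simp
  then have "Measurable.pred borel (\<lambda>u. \<forall>d\<in>D. c (act (ginv d) u) < k)" for k
    using fin_D by (intro pred_intros_finite)
  then show ?thesis unfolding settled_def[abs_def] by (rule measurable_Least)
qed

lemma swept_measurable: "swept \<in> borel_measurable borel"
proof -
  have "F i \<in> borel_measurable borel" for i using stage_labels[of i] by (simp add: labels_def)
  then show ?thesis
    unfolding swept_def[abs_def] by (rule measurable_compose_countable[OF _ settled_measurable])
qed

lemma swept_P:
  assumes y: "y \<in> free_points"
  shows "cfg swept y \<in> P"
proof (rule Lim_in_closed_set[OF flexibleD(1)[OF flex]])
  show "eventually (\<lambda>i. cfg (F i) y \<in> P) sequentially"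
    using stage_labels y by (simp add: labels_def)
  show "(\<lambda>i. cfg (F i) y) \<longlonglongrightarrow> cfg swept y"
  proof (rule tendsto_funI, rule tendsto_eventually)
    fix g
    show "eventually (\<lambda>i. cfg (F i) y g = cfg swept y g) sequentially"
      unfolding eventually_sequentially cfg_def swept_def
      using stage_settled by blast
  qed
qed simp

lemma swept_occurs:
  assumes "occurs (cfg (F i) y)"
  shows "occurs (cfg swept y)"
proof -
  define j where "j = i + (\<Sum>w\<in>W. settled (act w y))"
  have "settled (act w y) \<le> j" if "w \<in> W" for w
    unfolding j_def using fin_W that by (intro trans_le_add2 member_le_sum) auto
  then have "cfg (F j) y w = cfg swept y w" if "w \<in> W" for w
    using that stage_settled unfolding cfg_def swept_def by blast
  moreover have "occurs (cfg (F j) y)" by (rule stage_persists[OF assms]) (simp add: j_def)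
  ultimately show ?thesis by (simp add: occurs_def agree_def)
qed

lemma swept_near:
  assumes y: "y \<in> free_points"
  shows "near (cfg swept y)"
proof (cases "y \<in> Z (c y)")
  case True
  then have "occurs (cfg (F (Suc (c y))) y)" by (rule stage_occurs) simp
  then have "occurs (cfg swept y)" by (rule swept_occurs)
  then have "occurs (act one (cfg swept y))" by simp
  then show ?thesis using one_V unfolding near_def by blast
next
  case False
  then have "near (cfg (F (c y)) y)" using y by (simp add: bad_class_def)
  then obtain v where v: "v \<in> V" "occurs (cfg (F (c y)) (act v y))" by (auto simp: near_def cfg_act)
  have "occurs (act v (cfg swept y))" unfolding cfg_act[symmetric] by (rule swept_occurs[OF v(2)])
  then show ?thesis using v(1) unfolding near_def by blast
qed

lemma swept_labels: "labels syndetic swept"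
  unfolding labels_def syndetic_def
  using swept_measurable swept_P swept_near by (auto simp flip: cfg_act)

definition centres :: "(nat \<Rightarrow> real) set" where
  "centres = (\<Union>i. Z i)"

lemma centres_sets: "centres \<in> sets borel"
  unfolding centres_def using stage.Z_sets by (intro sets.countable_UN) auto

text \<open>Of two centres, the one treated first creates an occurrence that is never destroyed and that would
  have prevented planting at a later centre within \<open>V\<close> of it; centres treated at the same time have
  equal colours.\<close>

lemma centres_separated:
  assumes z: "z \<in> centres" "act s z \<in> centres" and s: "s \<in> V"
  shows "s = one"
proof (rule ccontr)
  assume "s \<noteq> one"
  obtain i j where i: "z \<in> Z i" and j: "act s z \<in> Z j" using z by (auto simp: centres_def)
  have free: "z \<in> free_points" using i by (simp add: bad_class_def)
  have ij: "i = c z" "j = c (act s z)" using i j by (auto simp: bad_class_def)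
  then have "i \<noteq> j" using c_separated[OF free] s \<open>s \<noteq> one\<close> by (metis UnI2)
  then consider "i < j" | "j < i" by linarith
  then show False
  proof cases
    case 1
    then have "occurs (act (ginv s) (cfg (F j) (act s z)))"
      using stage_occurs[OF i] by (simp flip: cfg_act)
    then have "near (cfg (F j) (act s z))" using inv_V[OF s] unfolding near_def by blast
    then show False using j by (simp add: bad_class_def)
  next
    case 2
    then have "occurs (act s (cfg (F i) z))"
      using stage_occurs[OF j] by (simp flip: cfg_act)
    then have "near (cfg (F i) z)" using s unfolding near_def by blast
    then show False using i by (simp add: bad_class_def)
  qed
qed

text \<open>The preimages of the set of centres under the elements of \<open>R\<close> are disjoint, because \<open>R R\<^sup>-\<^sup>1 \<subseteq> V\<close>.\<close>

lemma measure_centres: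
  assumes R: "finite R" "\<And>r r'. r \<in> R \<Longrightarrow> r' \<in> R \<Longrightarrow> r' \<cdot> ginv r \<in> V"
  shows "real (card R) * measure bernoulli centres \<le> 1"
proof -
  let ?A = "\<lambda>r. act r -` centres"
  have "disjoint_family_on ?A R"
    unfolding disjoint_family_on_def
  proof (intro ballI impI equals0I)
    fix r r' y assume r: "r \<in> R" "r' \<in> R" "r \<noteq> r'" and "y \<in> ?A r \<inter> ?A r'"
    then have "act r y \<in> centres" "act (r' \<cdot> ginv r) (act r y) \<in> centres" by (auto simp: act_act)
    then have "r' \<cdot> ginv r = one" using R(2)[OF r(1,2)] centres_separated by blast
    then show False using r(3) by (metis mul_inv_cancel(2) group_left_neutral)
  qed
  then have "measure bernoulli (\<Union>r\<in>R. ?A r) = (\<Sum>r\<in>R. measure bernoulli (?A r))"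
    using R(1) sets_act_vimage[OF centres_sets] by (intro B.finite_measure_finite_Union) auto
  also have "\<dots> = real (card R) * measure bernoulli centres"
    by (simp add: measure_act centres_sets)
  finally show ?thesis by (metis B.prob_le_1)
qed

lemma swept_change:
  assumes "swept u \<noteq> f u"
  shows "\<exists>d\<in>D. act (ginv d) u \<in> centres"
proof (rule ccontr)
  assume *: "\<not> ?thesis"
  have "F i u = f u" for i
  proof (induction i)
    case (Suc i)
    have "\<not> hit (Z i) u d" for d using * by (auto simp: hit_def centres_def)
    then show ?case using Suc by (simp add: patch_def)
  qed simp
  then show False using assms by (simp add: swept_def)
qed

lemma measure_swept_change:
  "\<exists>A. A \<in> sets borel \<and> (\<forall>u. u \<notin> A \<longrightarrow> swept u = f u) \<and>
    measure bernoulli A \<le> real (card D) * measure bernoulli centres"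
proof (intro exI conjI allI impI)
  let ?A = "\<Union>d\<in>D. act (ginv d) -` centres"
  show "?A \<in> sets borel" using fin_D sets_act_vimage[OF centres_sets] by (intro sets.finite_UN) auto
  show "swept u = f u" if "u \<notin> ?A" for u using swept_change[of u] that by auto
  have "measure bernoulli ?A \<le> (\<Sum>d\<in>D. measure bernoulli (act (ginv d) -` centres))"
    using fin_D sets_act_vimage[OF centres_sets] by (intro B.finite_measure_subadditive_finite) auto
  then show "measure bernoulli ?A \<le> real (card D) * measure bernoulli centres"
    by (simp add: measure_act centres_sets)
qed

end

section \<open>The minimal tower and its random points\<close>

context nat_group begin

definition close_refinement :: "real \<Rightarrow> config set \<Rightarrow> config set \<Rightarrow> bool" where
  "close_refinement \<epsilon> P P' \<longleftrightarrow> P' \<subseteq> P \<and> (\<forall>f. labels P f \<longrightarrow> (\<exists>f' A. labels P' f' \<and> A \<in> sets borel \<and>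
     measure bernoulli A \<le> \<epsilon> \<and> (\<forall>u. u \<notin> A \<longrightarrow> f' u = f u)))"

definition recurrent :: "config set \<Rightarrow> nat set \<Rightarrow> nat \<Rightarrow> config \<Rightarrow> bool" where
  "recurrent P W N p \<longleftrightarrow> (\<exists>V. finite V \<and> (\<forall>x\<in>P. \<exists>v\<in>V. agree W N (act v x) p))"

text \<open>The set \<open>V\<close> is chosen after \<open>D\<close>, so it may contain \<open>R R\<^sup>-\<^sup>1\<close> for a set \<open>R\<close> with more than
  \<open>|D| / \<epsilon>\<close> elements. Centres then have measure at most \<open>1 / |R|\<close>, and only their translates by \<open>D\<close>
  are altered.\<close>

lemma pattern_refinement:
  assumes flex: "flexible P" and p: "p \<in> P" and W: "finite W" and e: "\<epsilon> > 0"
  shows "\<exists>P'. flexible P' \<and> close_refinement \<epsilon> P P' \<and> recurrent P' W N p"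
proof -
  obtain D0 N' where D0: "finite D0"
    and glue: "\<And>x x'. x \<in> P \<Longrightarrow> x' \<in> P \<Longrightarrow> \<exists>u\<in>P. agree W N u x' \<and> agree_off D0 N' u x"
    using flexibleD(3)[OF flex] W unfolding gluing_def by metis
  define D where "D = D0 \<union> W"
  obtain K where K: "real (card D) / \<epsilon> < real K" using reals_Archimedean2 by blast
  define R where "R = {..<Suc K}"
  define V where "V = {one} \<union> setmul R (ginv ` R) \<union> setmul (ginv ` W) D \<union> setmul (ginv ` D) W"
  have ginv_mul: "ginv (a \<cdot> ginv b) = b \<cdot> ginv a" "ginv (ginv a \<cdot> b) = ginv b \<cdot> a" for a b
    by (simp_all add: inverse_distrib_swap)
  have V_R: "r' \<cdot> ginv r \<in> V" if "r \<in> R" "r' \<in> R" for r r'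
    using that unfolding V_def by (auto intro: setmulI)
  have V_W: "ginv w \<cdot> d \<in> V" "ginv d \<cdot> w \<in> V" if "w \<in> W" "d \<in> D" for w d
    using that unfolding V_def by (auto intro: setmulI)
  have one_V: "one \<in> V" by (simp add: V_def)
  interpret pattern_step mul one ginv P p W N D N' V
  proof unfold_locales
    show "finite D" "finite W" "finite V" using D0 W by (auto simp: D_def V_def R_def)
    show "\<exists>u\<in>P. agree W N u p \<and> agree_off D N' u x" if x: "x \<in> P" for x
    proof -
      obtain u where u: "u \<in> P" "agree W N u p" "agree_off D0 N' u x" using glue[OF x p] by blast
      have "agree_off D N' u x" using u(3) by (rule agree_off_mono) (auto simp: D_def)
      then show ?thesis using u by blast
    qed
    show "ginv v \<in> V" if "v \<in> V" for v
    proof -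
      from that consider "v = one" | a b where "a \<in> R" "b \<in> R" "v = a \<cdot> ginv b"
        | a b where "a \<in> W" "b \<in> D" "v = ginv a \<cdot> b" | a b where "a \<in> D" "b \<in> W" "v = ginv a \<cdot> b"
        unfolding V_def by (auto elim!: setmulE)
      then show ?thesis by cases (simp_all add: ginv_mul V_R V_W one_V inverse_neutral)
    qed
    show "ginv w \<cdot> d \<in> V" if "w \<in> W" "d \<in> D" for w d by (rule V_W(1)[OF that])
  qed (auto simp: flex D_def V_def)
  have "close_refinement \<epsilon> P syndetic"
    unfolding close_refinement_def
  proof (intro conjI allI impI)
    fix f assume f: "labels P f"
    obtain E0 where E0: "finite E0" and loc: "\<forall>u. (\<exists>x\<in>P. \<forall>d. \<forall>c\<ge>N'. u d c = x d c) \<and>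
        (\<forall>g. \<exists>x\<in>P. \<forall>d\<in>E0. u (d \<cdot> g) = x (d \<cdot> g)) \<longrightarrow> u \<in> P"
      using flexibleD(4)[OF flex, unfolded local_rule_def, THEN spec[of _ N']] by (elim exE conjE)
    define E where "E = insert one E0"
    define S where "S = setmul (setmul (ginv ` D) E) (setmul (ginv ` E) D) \<union> V - {one}"
    have S: "finite S" "one \<notin> S" using E0 fin_D fin_V by (auto simp: S_def E_def)
    obtain c :: "(nat \<Rightarrow> real) \<Rightarrow> nat" where c: "c \<in> measurable borel (count_space UNIV)"
      "\<forall>y\<in>free_points. \<forall>s\<in>S. c (act s y) \<noteq> c y"
      using separated_colouring[OF S] by blast
    interpret sweep mul one ginv P p W N D N' V E c f
    proof unfold_locales
      fix u assume u: "\<exists>x\<in>P. \<forall>d. \<forall>c\<ge>N'. u d c = x d c" "\<forall>g. \<exists>x\<in>P. \<forall>e\<in>E. u (e \<cdot> g) = x (e \<cdot> g)"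
      show "u \<in> P"
      proof (rule loc[THEN spec, THEN mp], intro conjI allI)
        fix g
        obtain x where "x \<in> P" "\<forall>e\<in>E. u (e \<cdot> g) = x (e \<cdot> g)" using u(2) by blast
        then show "\<exists>x\<in>P. \<forall>d\<in>E0. u (d \<cdot> g) = x (d \<cdot> g)" by (intro bexI[of _ x]) (auto simp: E_def)
      qed (rule u(1))
    next
      fix y s assume "y \<in> free_points" "s \<in> setmul (setmul (ginv ` D) E) (setmul (ginv ` E) D) \<union> V" "s \<noteq> one"
      then show "c (act s y) \<noteq> c y" using c(2) by (auto simp: S_def)
    qed (auto simp: E_def c(1) f)
    obtain A where A: "A \<in> sets borel" "\<forall>u. u \<notin> A \<longrightarrow> swept u = f u"
      "measure bernoulli A \<le> real (card D) * measure bernoulli centres" using measure_swept_change by blast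
    have "real (card R) * measure bernoulli centres \<le> 1"
      by (rule measure_centres) (auto simp: R_def intro: V_R[unfolded R_def])
    then have "measure bernoulli centres \<le> 1 / real (Suc K)"
      by (simp add: R_def field_simps)
    then have "real (card D) * measure bernoulli centres \<le> real (card D) * (1 / real (Suc K))"
      by (intro mult_left_mono) auto
    also have "\<dots> \<le> \<epsilon>" using K e by (simp add: field_simps)
    finally have "measure bernoulli A \<le> \<epsilon>" using A(3) by linarith
    then show "\<exists>f' A. labels syndetic f' \<and> A \<in> sets borel \<and> measure bernoulli A \<le> \<epsilon> \<and> (\<forall>u. u \<notin> A \<longrightarrow> f' u = f u)"
      using swept_labels A by blast
  qed (auto simp: syndetic_def)
  moreover have "recurrent syndetic W N p"
    unfolding recurrent_def
  proof (intro exI[of _ V] conjI ballI fin_V)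
    fix x assume "x \<in> syndetic"
    then have "near (act one x)" unfolding syndetic_def by blast
    then show "\<exists>v\<in>V. agree W N (act v x) p" by (simp add: near_def occurs_def)
  qed
  ultimately show ?thesis using flexible_syndetic by blast
qed

text \<open>Each stage treats one pattern, if the pattern still occurs at that stage. A pattern occurring in the
  intersection has occurred at its own stage, and is recurrent from then on.\<close>

lemma minimal_tower:
  "\<exists>Q :: nat \<Rightarrow> config set. Q 0 = coloured \<and> (\<forall>n. flexible (Q n)) \<and>
    (\<forall>n. close_refinement ((1/2)^(n+3)) (Q n) (Q (Suc n))) \<and>
    (\<forall>k. \<forall>x\<in>(\<Inter>n. Q n). \<exists>n. recurrent (Q n) {..<k} k x)"
proof -
  let ?step = "\<lambda>n P P'. close_refinement ((1/2)^(n+3)) P P' \<and> (\<forall>k i. prod_decode n = (k, i) \<longrightarrow>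
      (\<exists>x\<in>P. agree {..<k} k x (pat i)) \<longrightarrow> recurrent P' {..<k} k (pat i))"
  have "\<exists>Q. \<forall>n. (flexible (Q n) \<and> (n = 0 \<longrightarrow> Q n = coloured)) \<and> ?step n (Q n) (Q (Suc n))"
  proof (rule dependent_nat_choice)
    show "\<exists>P. flexible P \<and> ((0::nat) = 0 \<longrightarrow> P = coloured)" using flexible_coloured by blast
    fix P and n :: nat assume P: "flexible P \<and> (n = 0 \<longrightarrow> P = coloured)"
    obtain k i where ki: "prod_decode n = (k, i)" by force
    have "\<exists>P'. flexible P' \<and> ?step n P P'"
    proof (cases "\<exists>x\<in>P. agree {..<k} k x (pat i)")
      case True
      then obtain x where x: "x \<in> P" "agree {..<k} k x (pat i)" by blast
      obtain P' where P': "flexible P'" "close_refinement ((1/2)^(n+3)) P P'" "recurrent P' {..<k} k x"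
        using pattern_refinement[of P x "{..<k}" "(1/2)^(n+3)" k] P x(1) by auto
      have "agree {..<k} k y (pat i) \<longleftrightarrow> agree {..<k} k y x" for y
        using x(2) by (simp add: agree_def)
      then have "recurrent P' {..<k} k (pat i)" using P'(3) by (simp add: recurrent_def)
      then show ?thesis using P' ki by auto
    next
      case False
      have "close_refinement ((1/2)^(n+3)) P P" unfolding close_refinement_def
        by (intro conjI allI impI order_refl exI[of _ "{}"] exI) auto
      then show ?thesis using P False ki by auto
    qed
    then show "\<exists>P'. (flexible P' \<and> (Suc n = 0 \<longrightarrow> P' = coloured)) \<and> ?step n P P'" by simp
  qed
  then obtain Q where Q_all: "\<forall>n. (flexible (Q n) \<and> (n = 0 \<longrightarrow> Q n = coloured)) \<and> ?step n (Q n) (Q (Suc n))"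
    by (elim exE)
  have Q: "flexible (Q n)" "Q 0 = coloured" "close_refinement ((1/2)^(n+3)) (Q n) (Q (Suc n))" for n
    using Q_all by simp_all
  have step: "recurrent (Q (Suc n)) {..<k} k (pat i)"
    if "prod_decode n = (k, i)" "\<exists>x\<in>Q n. agree {..<k} k x (pat i)" for n k i
    using Q_all[THEN spec[of _ n]] that by simp
  have "\<exists>n. recurrent (Q n) {..<k} k x" if x: "x \<in> (\<Inter>n. Q n)" for k x
  proof -
    obtain i where i: "\<And>d c. d \<in> {..<k} \<Longrightarrow> c < k \<Longrightarrow> pat i d c = x d c"
      using pat_surj[of "{..<k}"] by blast
    have ag: "agree {..<k} k y (pat i) \<longleftrightarrow> agree {..<k} k y x" for y
      using i by (simp add: agree_def)
    let ?n = "prod_encode (k, i)"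
    have "recurrent (Q (Suc ?n)) {..<k} k (pat i)"
    proof (rule step)
      show "\<exists>x\<in>Q ?n. agree {..<k} k x (pat i)"
        using x ag by (intro bexI[of _ x]) (auto simp: agree_def)
    qed simp
    then show ?thesis by (auto simp: recurrent_def ag)
  qed
  with Q show ?thesis by (intro exI[of _ Q]) simp
qed

text \<open>Greedy colouring: treat the classes of a proper colouring with countably many colours in turn, and
  give each point a colour that its two neighbours do not have at that time. Of two neighbours, the one
  treated later sees the final colour of the other.\<close>

lemma measurable_colouring:
  assumes g: "g \<noteq> one"
  shows "\<exists>k :: (nat \<Rightarrow> real) \<Rightarrow> bool \<times> bool. k \<in> measurable borel (count_space UNIV) \<and>
    (\<forall>y\<in>free_points. k (act g y) \<noteq> k y)"
proof -
  have S: "finite {g}" "one \<notin> {g}" using g by auto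
  obtain c :: "(nat \<Rightarrow> real) \<Rightarrow> nat" where c: "c \<in> measurable borel (count_space UNIV)"
    "\<forall>y\<in>free_points. \<forall>s\<in>{g}. c (act s y) \<noteq> c y"
    using separated_colouring[OF S] by blast
  obtain pick :: "bool \<times> bool \<Rightarrow> bool \<times> bool \<Rightarrow> bool \<times> bool" where
    pick: "\<And>a b. pick a b \<noteq> a \<and> pick a b \<noteq> b" using third_colour by metis
  define K :: "nat \<Rightarrow> (nat \<Rightarrow> real) \<Rightarrow> bool \<times> bool" where
    "K = rec_nat (\<lambda>_. (False, False))
       (\<lambda>i h y. if c y = i then pick (h (act g y)) (h (act (ginv g) y)) else h y)"
  have K_Suc: "K (Suc i) y = (if c y = i then pick (K i (act g y)) (K i (act (ginv g) y)) else K i y)" for i y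
    by (simp add: K_def)
  have K_meas: "K i \<in> measurable borel (count_space UNIV)" for i
  proof (induction i)
    case 0
    then show ?case by (simp add: K_def)
  next
    case (Suc i)
    note m = measurable_compose[OF act_measurable Suc.IH]
    have "(\<lambda>y. pick a (K i (act (ginv g) y))) \<in> measurable borel (count_space UNIV)" for a
      by (rule measurable_compose[OF m]) simp
    then have "(\<lambda>y. pick (K i (act g y)) (K i (act (ginv g) y))) \<in> measurable borel (count_space UNIV)"
      by (rule measurable_compose_countable[OF _ m])
    moreover have "{y \<in> space borel. c y = i} \<in> sets borel"
      using measurable_sets[OF c(1), of "{i}"] by (simp add: vimage_def)
    ultimately have "(\<lambda>y. if c y = i then pick (K i (act g y)) (K i (act (ginv g) y)) else K i y) \<in> measurable borel (count_space UNIV)"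
      using Suc.IH by (intro measurable_If)
    then show ?case by (simp only: K_Suc[abs_def])
  qed
  define k where "k y = K (Suc (c y)) y" for y
  have K_k: "K i y = k y" if "c y < i" for i y
    using that
  proof (induction i)
    case (Suc i)
    then show ?case by (cases "c y = i") (auto simp: k_def K_Suc)
  qed simp
  have k_pick: "k y = pick (K (c y) (act g y)) (K (c y) (act (ginv g) y))" for y
    by (simp add: k_def K_Suc)
  have "k (act g y) \<noteq> k y" if "y \<in> free_points" for y
  proof -
    have "c (act g y) \<noteq> c y" using c(2) that by simp
    then consider "c (act g y) < c y" | "c y < c (act g y)" by linarith
    then show ?thesis
    proof cases
      case 1
      then have "K (c y) (act g y) = k (act g y)" by (rule K_k)
      then show ?thesis using pick by (metis k_pick)
    next
      case 2
      then have "K (c (act g y)) (act (ginv g) (act g y)) = k y" by (simp add: K_k)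
      then show ?thesis using pick by (metis k_pick)
    qed
  qed
  moreover have "k \<in> measurable borel (count_space UNIV)"
  proof -
    have "(\<lambda>y. K (Suc i) y) \<in> measurable borel (count_space UNIV)" for i by (rule K_meas)
    then show ?thesis unfolding k_def[abs_def] by (rule measurable_compose_countable[OF _ c(1)])
  qed
  ultimately show ?thesis by blast
qed

lemma initial_labelling:
  shows "\<exists>f. labels coloured f \<and> (\<forall>u. f u (2 * one) = b)"
proof -
  have "\<forall>g. \<exists>k :: (nat \<Rightarrow> real) \<Rightarrow> bool \<times> bool. g \<noteq> one \<longrightarrow> k \<in> measurable borel (count_space UNIV) \<and>
     (\<forall>y\<in>free_points. k (act g y) \<noteq> k y)"
    using measurable_colouring by blast
  then obtain k :: "nat \<Rightarrow> (nat \<Rightarrow> real) \<Rightarrow> bool \<times> bool" where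
    k: "\<And>g. g \<noteq> one \<Longrightarrow> k g \<in> measurable borel (count_space UNIV)"
      "\<And>g y. g \<noteq> one \<Longrightarrow> y \<in> free_points \<Longrightarrow> k g (act g y) \<noteq> k g y" by metis
  define f where "f u c = (if c div 2 = one then b else
    (if even c then fst else snd) (k (c div 2) u))" for u c
  have "labels coloured f"
    unfolding labels_def
  proof (intro conjI ballI)
    show "f \<in> borel_measurable borel"
    proof (rule measurable_coordinatewise_then_product)
      fix c
      show "(\<lambda>u. f u c) \<in> borel_measurable borel"
      proof (cases "c div 2 = one")
        case False
        have "(\<lambda>u. (if even c then fst else snd) (k (c div 2) u)) \<in> borel_measurable borel"
          by (rule measurable_compose[OF k(1)[OF False]]) simp
        then show ?thesis by (simp add: f_def False)
      qed (simp add: f_def)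
    qed
    fix y assume y: "y \<in> free_points"
    have "colour (cfg f y) g (g \<cdot> d) \<noteq> colour (cfg f y) g d" if g: "g \<noteq> one" for g d
    proof -
      have "colour (cfg f y) g a = k g (act a y)" for a
        using g by (simp add: colour_def cfg_def f_def)
      then show ?thesis using k(2)[OF g, of "act d y"] y by (simp add: act_act)
    qed
    then show "cfg f y \<in> coloured" by (simp add: coloured_def)
  qed
  moreover have "f u (2 * one) = b" for u by (simp add: f_def)
  ultimately show ?thesis by blast
qed

text \<open>The set \<open>Y\<close> consists of the injective points \<open>y\<close> for which every \<open>g y\<close> lies in finitely many of the
  exceptional sets of the refinements; there the labels are eventually constant. The bound
  \<open>1/4\<close> is the sum of the series \<open>\<Sum>\<^sub>n 2\<^sup>-\<^sup>n\<^sup>-\<^sup>3\<close>.\<close>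

lemma limit_labelling:
  assumes flex: "\<And>n. flexible (Q n)"
    and ref: "\<And>n. close_refinement ((1/2)^(n+3)) (Q n) (Q (Suc n))"
    and f0: "labels (Q 0) f0"
  shows "\<exists>h Y B. h \<in> borel_measurable borel \<and> Y \<in> sets borel \<and> (AE y in bernoulli. y \<in> Y) \<and>
    (\<forall>g y. act g y \<in> Y \<longleftrightarrow> y \<in> Y) \<and> (\<forall>y\<in>Y. cfg h y \<in> (\<Inter>n. Q n)) \<and>
    B \<in> sets borel \<and> measure bernoulli B \<le> 1/4 \<and> (\<forall>y. y \<notin> B \<longrightarrow> h y = f0 y)"
proof -
  have "\<exists>f. \<forall>n. (labels (Q n) (f n) \<and> (n = 0 \<longrightarrow> f n = f0)) \<and>
    (\<exists>A. A \<in> sets borel \<and> measure bernoulli A \<le> (1/2)^(n+3) \<and> (\<forall>u. u \<notin> A \<longrightarrow> f (Suc n) u = f n u))"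
  proof (rule dependent_nat_choice)
    show "\<exists>f. labels (Q 0) f \<and> ((0::nat) = 0 \<longrightarrow> f = f0)" using f0 by blast
    fix f and n :: nat assume "labels (Q n) f \<and> (n = 0 \<longrightarrow> f = f0)"
    then show "\<exists>f'. (labels (Q (Suc n)) f' \<and> (Suc n = 0 \<longrightarrow> f' = f0)) \<and>
        (\<exists>A. A \<in> sets borel \<and> measure bernoulli A \<le> (1/2)^(n+3) \<and> (\<forall>u. u \<notin> A \<longrightarrow> f' u = f u))"
      using ref[of n] unfolding close_refinement_def by simp
  qed
  then obtain f where f_all: "\<forall>n. (labels (Q n) (f n) \<and> (n = 0 \<longrightarrow> f n = f0)) \<and>
    (\<exists>A. A \<in> sets borel \<and> measure bernoulli A \<le> (1/2)^(n+3) \<and> (\<forall>u. u \<notin> A \<longrightarrow> f (Suc n) u = f n u))"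
    by (elim exE)
  have f: "labels (Q n) (f n)" "f 0 = f0" for n using f_all by simp_all
  have "\<forall>n. \<exists>A. A \<in> sets borel \<and> measure bernoulli A \<le> (1/2)^(n+3) \<and> (\<forall>u. u \<notin> A \<longrightarrow> f (Suc n) u = f n u)"
    using f_all by simp
  then obtain A where A_all: "\<forall>n. A n \<in> sets borel \<and> measure bernoulli (A n) \<le> (1/2)^(n+3) \<and>
      (\<forall>u. u \<notin> A n \<longrightarrow> f (Suc n) u = f n u)"
    by (rule choice[THEN exE])
  have A: "A n \<in> sets borel" "measure bernoulli (A n) \<le> (1/2)^(n+3)"
    "u \<notin> A n \<Longrightarrow> f (Suc n) u = f n u" for n u using A_all by simp_all
  have mono: "Q (Suc n) \<subseteq> Q n" for n using ref[of n] by (simp add: close_refinement_def)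
  have anti: "Q n \<subseteq> Q m" if "m \<le> n" for m n
    using that by (induction rule: dec_induct) (use mono in blast)+
  define h where "h u c \<longleftrightarrow> (\<exists>m. \<forall>n\<ge>m. f n u c)" for u c
  have h_eq: "h u = f m u" if "\<And>n. n \<ge> m \<Longrightarrow> u \<notin> A n" for u m
  proof -
    have const: "f n u = f m u" if "n \<ge> m" for n
      using that
    proof (induction rule: dec_induct)
      case (step n)
      then show ?case using A(3)[OF \<open>\<And>n. n \<ge> m \<Longrightarrow> u \<notin> A n\<close>] by simp
    qed simp
    show ?thesis
    proof
      fix c
      show "h u c = f m u c"
      proof
        assume "h u c"
        then obtain m' where "\<forall>n\<ge>m'. f n u c" by (auto simp: h_def)
        then have "f (max m m') u c" by simp
        then show "f m u c" using const[of "max m m'"] by simp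
      next
        assume "f m u c"
        then have "f n u c" if "n \<ge> m" for n unfolding const[OF that] .
        then show "h u c" unfolding h_def by (intro exI[of _ m] allI impI)
      qed
    qed
  qed
  have h_meas: "h \<in> borel_measurable borel"
  proof (rule measurable_coordinatewise_then_product)
    fix c
    have fc: "Measurable.pred borel (\<lambda>u. f n u c)" for n
    proof -
      have "f n \<in> borel_measurable borel" using f(1)[of n] by (simp add: labels_def)
      then have "(\<lambda>u. f n u c) \<in> borel_measurable borel" by (rule measurable_product_then_coordinatewise)
      then have "(\<lambda>u. f n u c) -` {True} \<in> sets borel"
        by (rule measurable_sets_borel) (simp add: borel_open open_discrete)
      then show ?thesis by (simp add: Measurable.pred_def vimage_def)
    qed
    have "Measurable.pred borel (\<lambda>u. m \<le> n \<longrightarrow> f n u c)" for m n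
      by (cases "m \<le> n") (simp_all add: fc)
    then have "Measurable.pred borel (\<lambda>u. \<exists>m. \<forall>n\<ge>m. f n u c)"
      by (rule pred_intros_countable(2)[OF pred_intros_countable(1)])
    then have "Measurable.pred borel (\<lambda>u. h u c)" by (simp only: h_def)
    then show "(\<lambda>u. h u c) \<in> borel_measurable borel"
      by (rule measurable_compose) simp
  qed
  have summ: "summable (\<lambda>n. measure bernoulli (A n))"
  proof (rule summable_comparison_test')
    show "summable (\<lambda>n. (1/2::real)^(n+3))" by (simp add: power_add summable_mult2)
    show "norm (measure bernoulli (A n)) \<le> (1/2)^(n+3)" for n using A(2) by simp
  qed
  define Y where "Y = {y \<in> free_points. \<forall>g. \<exists>m. \<forall>n\<ge>m. act g y \<notin> A n}"
  have Y_sets: "Y \<in> sets borel"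
  proof -
    have "- (act g -` A n) \<in> sets borel" for g n
      using sets.Diff[OF sets.top sets_act_vimage[OF A(1)[of n], of g]] by (simp add: Compl_eq_Diff_UNIV)
    moreover have "Y = free_points \<inter> (\<Inter>g. \<Union>m. \<Inter>n\<in>{n. n \<ge> m}. - (act g -` A n))"
      by (auto simp: Y_def)
    ultimately show ?thesis
      by (simp only:, intro sets.Int sets_free_points sets.countable_INT'' sets.countable_UN' countableI_type) auto
  qed
  have Y_AE: "AE y in bernoulli. y \<in> Y"
  proof -
    have "AE y in bernoulli. eventually (\<lambda>n. y \<in> space bernoulli - act g -` A n) sequentially" for g
    proof (rule borel_cantelli_AE1)
      show "act g -` A n \<in> sets bernoulli" for n using sets_act_vimage[OF A(1)] by simp
      show "summable (\<lambda>n. measure bernoulli (act g -` A n))" using summ by (simp add: measure_act A(1))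
      show "emeasure bernoulli (act g -` A n) < \<infinity>" for n
        by (simp add: B.emeasure_eq_measure)
    qed
    then have "AE y in bernoulli. \<forall>g. eventually (\<lambda>n. y \<in> space bernoulli - act g -` A n) sequentially"
      by (simp add: AE_all_countable)
    with AE_free_points show ?thesis
      by eventually_elim (auto simp: Y_def eventually_sequentially)
  qed
  have Y_act: "act g y \<in> Y" if "y \<in> Y" for g y
    using that unfolding Y_def by (simp add: act_act)
  have Y_act_iff: "act g y \<in> Y \<longleftrightarrow> y \<in> Y" for g y
    using Y_act[of y g] Y_act[of "act g y" "ginv g"] by auto
  have Y_Q: "cfg h y \<in> Q m" if y: "y \<in> Y" for y m
  proof (rule Lim_in_closed_set[OF flexibleD(1)[OF flex]])
    have free: "y \<in> free_points" using y by (simp add: Y_def)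
    show "eventually (\<lambda>n. cfg (f n) y \<in> Q m) sequentially"
      unfolding eventually_sequentially
    proof (intro exI[of _ m] allI impI)
      fix n assume "m \<le> n"
      moreover have "cfg (f n) y \<in> Q n" using f(1)[of n] free by (simp add: labels_def)
      ultimately show "cfg (f n) y \<in> Q m" using anti by blast
    qed
    show "(\<lambda>n. cfg (f n) y) \<longlonglongrightarrow> cfg h y"
    proof (rule tendsto_funI, rule tendsto_eventually)
      fix g
      obtain k where k: "\<forall>n\<ge>k. act g y \<notin> A n" using y unfolding Y_def by blast
      have "cfg (f n) y g = cfg h y g" if "n \<ge> k" for n
        using k that h_eq[of n "act g y"] by (simp add: cfg_def)
      then show "eventually (\<lambda>n. cfg (f n) y g = cfg h y g) sequentially"
        unfolding eventually_sequentially by blast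
    qed
  qed simp
  define B where "B = (\<Union>n. A n)"
  have "measure bernoulli B \<le> (\<Sum>n. measure bernoulli (A n))"
    unfolding B_def using A(1) summ by (intro B.finite_measure_subadditive_countably) auto
  also have "\<dots> \<le> (\<Sum>n. (1/2::real)^(n+3))"
    by (intro suminf_le A(2) summ) (simp add: power_add summable_mult2)
  also have "\<dots> = 1/4"
  proof -
    have "(\<Sum>n. (1/2::real)^(n+3)) = (\<Sum>n. (1/2)^n) * (1/2)^3"
      by (simp add: power_add suminf_mult2)
    also have "\<dots> = 1/4" by (simp add: suminf_geometric power3_eq_cube)
    finally show ?thesis .
  qed
  finally have "measure bernoulli B \<le> 1/4" .
  moreover have "B \<in> sets borel" unfolding B_def using A(1) by (intro sets.countable_UN) auto
  moreover have "h y = f0 y" if "y \<notin> B" for y using h_eq[of 0 y] that f(2) by (auto simp: B_def)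
  ultimately show ?thesis
    by (intro exI[of _ h] exI[of _ Y] exI[of _ B] conjI allI ballI impI INT_I h_meas Y_sets Y_AE Y_act_iff Y_Q)
qed

section \<open>Transport to the Cantor set\<close>

definition flat :: "config \<Rightarrow> cantor" where
  "flat x i = x (fst (prod_decode i)) (snd (prod_decode i))"

definition unflat :: "cantor \<Rightarrow> config" where
  "unflat z d c = z (prod_encode (d, c))"

lemma unflat_flat [simp]: "unflat (flat x) = x" and flat_unflat [simp]: "flat (unflat z) = z"
  by (simp_all add: flat_def unflat_def fun_eq_iff)

lemma continuous_on_flat: "continuous_on S flat"
  by (rule continuous_on_coordinatewise_then_product)
    (auto simp: flat_def intro: continuous_on_subset[OF continuous_on_config_coordinate])

lemma continuous_on_unflat: "continuous_on S unflat"
  by (intro continuous_on_coordinatewise_then_product)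
    (auto simp: unflat_def intro: continuous_on_subset[OF continuous_on_product_coordinates])

lemma continuous_on_act: "continuous_on S (act g :: config \<Rightarrow> config)"
  by (rule continuous_on_coordinatewise_then_product)
    (auto simp: act_def intro: continuous_on_subset[OF continuous_on_product_coordinates])

lemma flat_agree:
  assumes "agree {..<n} n y x" "i < n"
  shows "flat y i = flat x i"
proof -
  have "fst (prod_decode i) \<le> i" "snd (prod_decode i) \<le> i"
    using le_prod_encode_1 le_prod_encode_2 by (metis prod.collapse prod_decode_inverse)+
  then show ?thesis using assms by (simp add: flat_def agree_def)
qed

lemma open_config_agree:
  assumes "open U" "x \<in> U"
  obtains k where "{y. agree {..<k} k y x} \<subseteq> U"
proof -
  have "open (unflat -` U)" by (rule open_vimage[OF assms(1) continuous_on_unflat])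
  then obtain n where n: "{z. \<forall>i<n. z i = flat x i} \<subseteq> unflat -` U"
    using open_cantorE[of "unflat -` U" "flat x"] assms(2) by auto
  have "y \<in> U" if y: "agree {..<n} n y x" for y
  proof -
    have "flat y \<in> unflat -` U" using n flat_agree[OF y] by blast
    then show ?thesis by simp
  qed
  then show thesis using that by blast
qed

end

context nat_group begin

definition ergodic_for :: "(nat \<Rightarrow> cantor \<Rightarrow> cantor) \<Rightarrow> cantor measure \<Rightarrow> bool" where
  "ergodic_for \<phi> \<mu> \<longleftrightarrow> prob_space \<mu> \<and> sets \<mu> = sets borel \<and> (\<forall>g. distr \<mu> \<mu> (\<phi> g) = \<mu>) \<and>
     (\<forall>A\<in>sets borel. (\<forall>g. \<phi> g -` A = A) \<longrightarrow> measure \<mu> A = 0 \<or> measure \<mu> A = 1)"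

context
  fixes X :: "config set" and \<psi> :: "config \<Rightarrow> cantor" and \<psi>' :: "cantor \<Rightarrow> config"
  assumes homeo: "homeomorphism X UNIV \<psi> \<psi>'" and X_act: "\<And>x g. x \<in> X \<Longrightarrow> act g x \<in> X"
begin

lemma \<psi>_facts: "\<psi>' z \<in> X" "\<psi> (\<psi>' z) = z" "x \<in> X \<Longrightarrow> \<psi>' (\<psi> x) = x"
  "continuous_on X \<psi>" "continuous_on UNIV \<psi>'"
  using homeo unfolding homeomorphism_def by auto

definition conj_action :: "nat \<Rightarrow> cantor \<Rightarrow> cantor" where
  "conj_action g z = \<psi> (act g (\<psi>' z))"

lemma conj_action_one: "conj_action one z = z"
  by (simp add: conj_action_def \<psi>_facts)

lemma conj_action_mul: "conj_action g (conj_action h z) = conj_action (g \<cdot> h) z"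
  by (simp add: conj_action_def \<psi>_facts X_act act_act)

lemma conj_action_continuous: "continuous_on UNIV (conj_action g)"
proof -
  have "continuous_on UNIV (\<lambda>z. act g (\<psi>' z))"
    by (rule continuous_on_compose2[OF continuous_on_act[of UNIV] \<psi>_facts(5)]) simp
  then have "continuous_on UNIV (\<lambda>z. \<psi> (act g (\<psi>' z)))"
    by (rule continuous_on_compose2[OF \<psi>_facts(4)]) (auto intro: X_act \<psi>_facts(1))
  then show ?thesis by (simp only: conj_action_def[abs_def])
qed

lemma conj_action_free:
  assumes "\<And>x g. x \<in> X \<Longrightarrow> g \<noteq> one \<Longrightarrow> act g x \<noteq> x" "g \<noteq> one"
  shows "conj_action g z \<noteq> z"
proof
  assume "conj_action g z = z"
  then have "\<psi>' (\<psi> (act g (\<psi>' z))) = \<psi>' z" by (simp add: conj_action_def)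
  then have "act g (\<psi>' z) = \<psi>' z" using \<psi>_facts(1,3) X_act by metis
  then show False using assms \<psi>_facts(1) by blast
qed

lemma conj_action_minimal:
  assumes dense: "\<And>k x x'. x \<in> X \<Longrightarrow> x' \<in> X \<Longrightarrow> \<exists>g. agree {..<k} k (act g x') x"
  shows "closure (range (\<lambda>g. conj_action g z)) = UNIV"
proof -
  have "b \<in> closure (range (\<lambda>g. conj_action g z))" for b
    unfolding closure_iff_nhds_not_empty
  proof (intro allI impI)
    fix A V assume V: "V \<subseteq> A" "open V" "b \<in> V"
    have "\<psi> (\<psi>' b) \<in> V" using V(3) \<psi>_facts(2) by simp
    then obtain U where U: "open U" "\<psi>' b \<in> U" "\<And>x. x \<in> X \<Longrightarrow> x \<in> U \<Longrightarrow> \<psi> x \<in> V"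
      using \<psi>_facts(4)[unfolded continuous_on_topological] V(2) \<psi>_facts(1) by metis
    obtain k where k: "{y. agree {..<k} k y (\<psi>' b)} \<subseteq> U" using open_config_agree[OF U(1,2)] by blast
    obtain g where "agree {..<k} k (act g (\<psi>' z)) (\<psi>' b)" using dense \<psi>_facts(1) by blast
    then have "\<psi> (act g (\<psi>' z)) \<in> V" using k U(3) X_act \<psi>_facts(1) by blast
    then show "range (\<lambda>g. conj_action g z) \<inter> A \<noteq> {}" using V(1) by (auto simp: conj_action_def)
  qed
  then show ?thesis by blast
qed

text \<open>The image measure is described on all Borel sets, so that the two measures can be told apart later.\<close>

lemma ergodic_image:
  assumes h: "h \<in> borel_measurable borel" and Y: "Y \<in> sets borel" "AE y in bernoulli. y \<in> Y"
    "\<And>g y. act g y \<in> Y \<longleftrightarrow> y \<in> Y" "\<And>y. y \<in> Y \<Longrightarrow> cfg h y \<in> X"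
  shows "\<exists>\<mu>. ergodic_for conj_action \<mu> \<and> (\<forall>C\<in>sets borel. measure \<mu> C =
    measure bernoulli {y \<in> Y. \<psi> (cfg h y) \<in> C}) \<and> (\<forall>C\<in>sets borel. {y \<in> Y. \<psi> (cfg h y) \<in> C} \<in> sets borel)"
proof -
  \<comment> \<open>Off the null set \<open>- Y\<close> any value in \<open>X\<close> will do; the image of a constant sequence is one.\<close>
  define F where "F y = (if y \<in> Y then cfg h y else \<psi>' (\<lambda>_. False))" for y
  define T where "T y = \<psi> (F y)" for y
  have F_X: "F y \<in> X" for y using Y(4) \<psi>_facts(1) by (simp add: F_def)
  have F_meas: "F \<in> borel_measurable borel"
    unfolding F_def[abs_def] using Y(1) by (intro measurable_If_set cfg_measurable h measurable_const) simp_all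
  have T_meas: "T \<in> borel_measurable borel"
  proof -
    have "F \<in> measurable borel (restrict_space borel X)"
      using F_meas F_X by (intro measurable_restrict_space2) auto
    moreover have "\<psi> \<in> borel_measurable (restrict_space borel X)"
      by (rule borel_measurable_continuous_on_restrict[OF \<psi>_facts(4)])
    ultimately have "(\<lambda>y. \<psi> (F y)) \<in> borel_measurable borel" by (rule measurable_compose)
    then show ?thesis by (simp only: T_def[abs_def])
  qed
  then have T_meas': "T \<in> measurable bernoulli borel" by (simp cong: measurable_cong_sets)
  have act_meas: "act g \<in> measurable bernoulli bernoulli" for g
    using act_measurable by (simp cong: measurable_cong_sets)
  have \<phi>_meas: "conj_action g \<in> measurable borel borel" for g
    by (rule borel_measurable_continuous_onI[OF conj_action_continuous])
  have T_act: "T (act g y) = conj_action g (T y)" if "y \<in> Y" for g y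
    using that Y(3,4) by (simp add: T_def F_def conj_action_def \<psi>_facts(3) cfg_act)
  define \<mu> where "\<mu> = distr bernoulli borel T"
  have \<mu>_sets: "sets \<mu> = sets borel" by (simp add: \<mu>_def)
  have TC: "T -` C \<in> sets borel" if "C \<in> sets borel" for C
    using measurable_sets_borel[OF T_meas that] .
  have meas: "measure \<mu> C = measure bernoulli {y \<in> Y. \<psi> (cfg h y) \<in> C}"
    and C_sets: "{y \<in> Y. \<psi> (cfg h y) \<in> C} \<in> sets borel" if C: "C \<in> sets borel" for C
  proof -
    have eq: "{y \<in> Y. \<psi> (cfg h y) \<in> C} = Y \<inter> T -` C" by (auto simp: T_def F_def)
    show "{y \<in> Y. \<psi> (cfg h y) \<in> C} \<in> sets borel" unfolding eq using Y(1) TC[OF C] by (rule sets.Int)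
    have "measure \<mu> C = measure bernoulli (T -` C)"
      unfolding \<mu>_def using measure_distr[OF T_meas' C] by simp
    also have "\<dots> = measure bernoulli (Y \<inter> T -` C)"
      using Y(1,2) TC[OF C] by (intro measure_eq_AE) auto
    finally show "measure \<mu> C = measure bernoulli {y \<in> Y. \<psi> (cfg h y) \<in> C}" unfolding eq .
  qed
  have "distr \<mu> \<mu> (conj_action g) = \<mu>" for g
  proof -
    have "distr \<mu> \<mu> (conj_action g) = distr \<mu> borel (conj_action g)"
      by (rule distr_cong) (simp_all add: \<mu>_sets)
    also have "\<dots> = distr bernoulli borel (conj_action g \<circ> T)"
      unfolding \<mu>_def by (rule distr_distr[OF \<phi>_meas T_meas'])
    also have "\<dots> = distr bernoulli borel (T \<circ> act g)"
    proof (rule distr_cong_AE)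
      show "AE y in bernoulli. (conj_action g \<circ> T) y = (T \<circ> act g) y"
        using Y(2) by eventually_elim (simp add: T_act)
      show "conj_action g \<circ> T \<in> measurable bernoulli borel" by (rule measurable_comp[OF T_meas' \<phi>_meas])
      show "T \<circ> act g \<in> measurable bernoulli borel" by (rule measurable_comp[OF act_meas T_meas'])
    qed simp_all
    also have "\<dots> = distr (distr bernoulli bernoulli (act g)) borel T"
      by (rule distr_distr[OF T_meas' act_meas, symmetric])
    also have "\<dots> = \<mu>" by (simp add: act_measure_preserving \<mu>_def)
    finally show ?thesis .
  qed
  moreover have "measure \<mu> A = 0 \<or> measure \<mu> A = 1"
    if A: "A \<in> sets borel" "\<forall>g. conj_action g -` A = A" for A
  proof -
    have "act g -` {y \<in> Y. \<psi> (cfg h y) \<in> A} = {y \<in> Y. \<psi> (cfg h y) \<in> A}" for g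
    proof -
      have "T (act g y) \<in> A \<longleftrightarrow> T y \<in> A" if "y \<in> Y" for y
        unfolding T_act[OF that] using A(2) by blast
      then have "\<psi> (cfg h (act g y)) \<in> A \<longleftrightarrow> \<psi> (cfg h y) \<in> A" if "y \<in> Y" for y
        using that Y(3) by (simp add: T_def F_def)
      then show ?thesis using Y(3) by auto
    qed
    then show ?thesis unfolding meas[OF A(1)] by (intro bernoulli_ergodic C_sets A(1))
  qed
  moreover have "prob_space \<mu>" unfolding \<mu>_def by (rule B.prob_space_distr[OF T_meas'])
  ultimately have "ergodic_for conj_action \<mu>" by (simp add: ergodic_for_def \<mu>_sets)
  then show ?thesis using meas C_sets by blast
qed

end

text \<open>If \<open>x\<close> were the only member with its pattern on the window, every translate of \<open>x\<close> would return to
  \<open>x\<close> under an element of the finite set \<open>V\<close>; by freeness the group would be \<open>V\<^sup>-\<^sup>1\<close>.\<close>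

lemma free_recurrent_perfect:
  assumes free: "\<And>x g. x \<in> X \<Longrightarrow> g \<noteq> one \<Longrightarrow> act g x \<noteq> x"
    and X_act: "\<And>x g. x \<in> X \<Longrightarrow> act g x \<in> X" and x: "x \<in> X" and rec: "recurrent X {..<k} k x"
  shows "\<exists>x'\<in>X. x' \<noteq> x \<and> agree {..<k} k x' x"
proof (rule ccontr)
  assume *: "\<not> ?thesis"
  obtain V where V: "finite V" "\<And>y. y \<in> X \<Longrightarrow> \<exists>v\<in>V. agree {..<k} k (act v y) x"
    using rec by (auto simp: recurrent_def)
  have "g \<in> ginv ` V" for g
  proof -
    obtain v where v: "v \<in> V" "agree {..<k} k (act (v \<cdot> g) x) x"
      using V(2)[OF X_act[OF x, of g]] by (auto simp: act_act)
    have "act (v \<cdot> g) x = x" using * v(2) X_act[OF x] by blast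
    then have "v \<cdot> g = one" using free[OF x] by blast
    then have "g = ginv v" by (metis inverse_unique)
    then show ?thesis using v(1) by blast
  qed
  then have "(UNIV :: nat set) \<subseteq> ginv ` V" by blast
  then show False using V(1) finite_subset[of UNIV "ginv ` V"] by simp
qed

theorem free_minimal_action_with_two_ergodic_measures:
  "\<exists>\<phi> :: nat \<Rightarrow> cantor \<Rightarrow> cantor. (\<forall>z. \<phi> one z = z) \<and> (\<forall>g h z. \<phi> g (\<phi> h z) = \<phi> (g \<cdot> h) z) \<and>
    (\<forall>g. continuous_on UNIV (\<phi> g)) \<and> (\<forall>g z. g \<noteq> one \<longrightarrow> \<phi> g z \<noteq> z) \<and>
    (\<forall>z. closure (range (\<lambda>g. \<phi> g z)) = UNIV) \<and>
    (\<exists>\<mu> \<nu>. ergodic_for \<phi> \<mu> \<and> ergodic_for \<phi> \<nu> \<and> \<mu> \<noteq> \<nu>)"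
proof -
  obtain Q where Q0: "Q 0 = coloured" and flex: "\<forall>n. flexible (Q n)"
    and ref: "\<forall>n. close_refinement ((1/2)^(n+3)) (Q n) (Q (Suc n))"
    and rec: "\<forall>k. \<forall>x\<in>(\<Inter>n. Q n). \<exists>n. recurrent (Q n) {..<k} k x"
    using minimal_tower by (elim exE conjE)
  define X where "X = (\<Inter>n. Q n)"
  have X_act: "act g x \<in> X" if "x \<in> X" for x g
    using that flex flexibleD(2) unfolding X_def by blast
  have X_free: "act g x \<noteq> x" if "x \<in> X" "g \<noteq> one" for x g
    using that coloured_free Q0 unfolding X_def by blast
  have X_rec: "recurrent X {..<k} k x" if "x \<in> X" for k x
  proof -
    obtain n where "recurrent (Q n) {..<k} k x" using rec \<open>x \<in> X\<close> unfolding X_def by blast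
    then show ?thesis unfolding recurrent_def X_def by blast
  qed
  have X_closed: "closed X" unfolding X_def using flex flexibleD(1) by (intro closed_INT) blast
  have lab: "\<exists>h Y B. h \<in> borel_measurable borel \<and> Y \<in> sets borel \<and> (AE y in bernoulli. y \<in> Y) \<and>
    (\<forall>g y. act g y \<in> Y \<longleftrightarrow> y \<in> Y) \<and> (\<forall>y\<in>Y. cfg h y \<in> X) \<and>
    B \<in> sets borel \<and> measure bernoulli B \<le> 1/4 \<and> (\<forall>y. y \<notin> B \<longrightarrow> h y (2 * one) = b)" for b
  proof -
    obtain f0 where f0: "labels coloured f0" "\<forall>u. f0 u (2 * one) = b" using initial_labelling by blast
    have "labels (Q 0) f0" using f0(1) Q0 by simp
    from limit_labelling[OF flex[rule_format] ref[rule_format] this]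
    obtain h Y B where "h \<in> borel_measurable borel" "Y \<in> sets borel" "AE y in bernoulli. y \<in> Y"
      "\<forall>g y. act g y \<in> Y \<longleftrightarrow> y \<in> Y" "\<forall>y\<in>Y. cfg h y \<in> X" "B \<in> sets borel"
      "measure bernoulli B \<le> 1/4" and h: "\<forall>y. y \<notin> B \<longrightarrow> h y = f0 y"
      unfolding X_def[symmetric] by (elim exE conjE)
    moreover have "\<forall>y. y \<notin> B \<longrightarrow> h y (2 * one) = b" using h f0(2) by simp
    ultimately show ?thesis by (intro exI[of _ h] exI[of _ Y] exI[of _ B] conjI)
  qed
  have X_ne: "X \<noteq> {}"
  proof -
    obtain h Y where Y: "AE y in bernoulli. y \<in> Y" "\<forall>y\<in>Y. cfg h y \<in> X"
      using lab[of True] by (elim exE conjE)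
    have "Y \<noteq> {}"
    proof
      assume "Y = {}"
      then have "AE y in bernoulli. False" using Y(1) by simp
      then show False using B.AE_False by simp
    qed
    then show ?thesis using Y(2) by blast
  qed
  have "\<exists>\<psi> \<psi>'. homeomorphism X (UNIV :: cantor set) \<psi> \<psi>'"
  proof -
    have vim: "flat ` X = unflat -` X"
      by (auto simp: image_iff) (metis flat_unflat)
    have hom1: "homeomorphism X (flat ` X) flat unflat"
      by (rule homeomorphismI) (auto intro: continuous_on_flat continuous_on_unflat)
    have "closed (flat ` X)" unfolding vim by (rule closed_vimage[OF X_closed continuous_on_unflat])
    moreover have "flat ` X \<noteq> {}" using X_ne by simp
    moreover have "\<exists>z'\<in>flat ` X. z' \<noteq> z \<and> (\<forall>i<n. z' i = z i)" if z: "z \<in> flat ` X" for z n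
    proof -
      obtain x where x: "x \<in> X" "z = flat x" using z by blast
      obtain x' where x': "x' \<in> X" "x' \<noteq> x" "agree {..<n} n x' x"
        using free_recurrent_perfect[OF X_free X_act x(1) X_rec[OF x(1)]] by blast
      have "flat x' \<noteq> z" using x'(2) x(2) by (metis unflat_flat)
      moreover have "\<forall>i<n. flat x' i = z i" using flat_agree[OF x'(3)] x(2) by simp
      ultimately show ?thesis using x'(1) by blast
    qed
    ultimately obtain h h' where "homeomorphism (flat ` X) (UNIV :: cantor set) h h'"
      by (rule perfect_homeomorphic_cantor)
    with hom1 show ?thesis by (blast intro: homeomorphism_compose)
  qed
  then obtain \<psi> \<psi>' where homeo: "homeomorphism X (UNIV :: cantor set) \<psi> \<psi>'" by blast
  note facts = \<psi>_facts[OF homeo X_act]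
  let ?\<phi> = "conj_action \<psi> \<psi>'"
  \<comment> \<open>The bit \<open>2 * one\<close> is the first of the two unconstrained bits, read at the identity.\<close>
  let ?C = "{z. \<psi>' z one (2 * one)}"
  have C: "?C \<in> sets borel"
  proof -
    have "closed (\<psi>' -` {x. x one (2 * one) = True})"
      by (rule closed_vimage[OF closed_config_coordinate facts(5)])
    then show ?thesis by (intro borel_closed) (simp add: vimage_def)
  qed
  have erg: "\<exists>\<mu>. ergodic_for ?\<phi> \<mu> \<and> (if b then measure \<mu> ?C \<ge> 3/4 else measure \<mu> ?C \<le> 1/4)" for b
  proof -
    obtain h Y B where h: "h \<in> borel_measurable borel" and Y: "Y \<in> sets borel" "AE y in bernoulli. y \<in> Y"
      "\<forall>g y. act g y \<in> Y \<longleftrightarrow> y \<in> Y" "\<forall>y\<in>Y. cfg h y \<in> X"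
      and B: "B \<in> sets borel" "measure bernoulli B \<le> 1/4" "\<forall>y. y \<notin> B \<longrightarrow> h y (2 * one) = b"
      using lab[of b] by (elim exE conjE)
    obtain \<mu> where \<mu>: "ergodic_for ?\<phi> \<mu>"
      "measure \<mu> ?C = measure bernoulli {y \<in> Y. \<psi> (cfg h y) \<in> ?C}" "{y \<in> Y. \<psi> (cfg h y) \<in> ?C} \<in> sets borel"
      using ergodic_image[OF homeo X_act h Y(1,2) Y(3)[rule_format] Y(4)[rule_format]] C by blast
    have S: "{y \<in> Y. \<psi> (cfg h y) \<in> ?C} = {y \<in> Y. h y (2 * one)}"
      using Y(4) facts(3) by (auto simp: cfg_def)
    have "(if b then measure \<mu> ?C \<ge> 3/4 else measure \<mu> ?C \<le> 1/4)"
    proof (cases b)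
      case True
      have "measure bernoulli (UNIV - B) \<le> measure bernoulli {y \<in> Y. h y (2 * one)}"
        using Y(2) B(3) True \<mu>(3) unfolding S by (intro B.finite_measure_mono_AE) auto
      moreover have "measure bernoulli (UNIV - B) = 1 - measure bernoulli B"
        using B.prob_compl[of B] B(1) by simp
      ultimately show ?thesis using B(2) True \<mu>(2) S by simp
    next
      case False
      have "measure bernoulli {y \<in> Y. h y (2 * one)} \<le> measure bernoulli B"
        using B(1,3) False by (intro B.finite_measure_mono) auto
      then show ?thesis using B(2) False \<mu>(2) S by simp
    qed
    then show ?thesis using \<mu>(1) by blast
  qed
  obtain \<mu> where \<mu>: "ergodic_for ?\<phi> \<mu>" "measure \<mu> ?C \<ge> 3/4" using erg[of True] by auto
  obtain \<nu> where \<nu>: "ergodic_for ?\<phi> \<nu>" "measure \<nu> ?C \<le> 1/4" using erg[of False] by auto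
  have "\<mu> \<noteq> \<nu>" using \<mu>(2) \<nu>(2) by auto
  have dense: "\<exists>g. agree {..<k} k (act g x') x" if "x \<in> X" "x' \<in> X" for k x x'
    using X_rec[OF that(1), of k] that(2) by (auto simp: recurrent_def)
  show ?thesis
    using conj_action_one[OF homeo X_act] conj_action_mul[OF homeo X_act]
      conj_action_continuous[OF homeo X_act] conj_action_free[OF homeo X_act X_free]
      conj_action_minimal[OF homeo X_act dense] \<mu>(1) \<nu>(1) \<open>\<mu> \<noteq> \<nu>\<close>
    by (intro exI[of _ ?\<phi>] conjI allI impI exI[of _ \<mu>] exI[of _ \<nu>])
qed

end

theorem corollary1p1:
  fixes \<Gamma> :: "('g, 'r) monoid_scheme"
  assumes "group \<Gamma>"
    and "countable (carrier \<Gamma>)"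
    and "infinite (carrier \<Gamma>)"
  shows "\<exists>\<phi> :: 'g \<Rightarrow> cantor \<Rightarrow> cantor.
    continuous_action \<Gamma> \<phi> \<and> free_action \<Gamma> \<phi> \<and> minimal_action \<Gamma> \<phi> \<and>
    (\<exists>\<mu> \<nu>. ergodic_invariant_borel_prob \<Gamma> \<phi> \<mu> \<and> ergodic_invariant_borel_prob \<Gamma> \<phi> \<nu> \<and> \<mu> \<noteq> \<nu>)"
proof -
  interpret \<Gamma>: group \<Gamma> by fact
  define enc where "enc = to_nat_on (carrier \<Gamma>)"
  define dec where "dec = from_nat_into (carrier \<Gamma>)"
  have enc_dec: "enc (dec n) = n" for n
    using assms(2,3) by (simp add: enc_def dec_def)
  have dec_enc: "dec (enc g) = g" if "g \<in> carrier \<Gamma>" for g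
    using assms(2) that by (simp add: enc_def dec_def)
  have dec_mem: "dec n \<in> carrier \<Gamma>" for n
    unfolding dec_def by (rule from_nat_into) (use assms(3) in auto)
  define mul where "mul a b = enc (dec a \<otimes>\<^bsub>\<Gamma>\<^esub> dec b)" for a b
  define one' where "one' = enc \<one>\<^bsub>\<Gamma>\<^esub>"
  define ginv where "ginv a = enc (inv\<^bsub>\<Gamma>\<^esub> dec a)" for a
  interpret N: nat_group mul one' ginv
    by unfold_locales (simp_all add: mul_def one'_def ginv_def dec_enc dec_mem enc_dec \<Gamma>.m_assoc)
  obtain \<phi> \<mu> \<nu> where \<phi>_one: "\<forall>z. \<phi> one' z = z" and \<phi>_mul: "\<forall>g h z. \<phi> g (\<phi> h z) = \<phi> (mul g h) z"
    and \<phi>_cont: "\<forall>g. continuous_on UNIV (\<phi> g)" and \<phi>_free: "\<forall>g z. g \<noteq> one' \<longrightarrow> \<phi> g z \<noteq> z"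
    and \<phi>_min: "\<forall>z. closure (range (\<lambda>g. \<phi> g z)) = UNIV"
    and erg: "N.ergodic_for \<phi> \<mu>" "N.ergodic_for \<phi> \<nu>" "\<mu> \<noteq> \<nu>"
    using N.free_minimal_action_with_two_ergodic_measures by (elim exE conjE)
  define \<Phi> where "\<Phi> g = \<phi> (enc g)" for g
  have enc_mul: "enc (g \<otimes>\<^bsub>\<Gamma>\<^esub> h) = mul (enc g) (enc h)" if "g \<in> carrier \<Gamma>" "h \<in> carrier \<Gamma>" for g h
    using that by (simp add: mul_def dec_enc)
  have range: "\<Phi> ` carrier \<Gamma> = range \<phi>"
    unfolding \<Phi>_def by (auto simp: image_iff) (metis enc_dec dec_mem)
  have \<Phi>_mul: "\<Phi> (g \<otimes>\<^bsub>\<Gamma>\<^esub> h) = \<Phi> g \<circ> \<Phi> h" if "g \<in> carrier \<Gamma>" "h \<in> carrier \<Gamma>" for g h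
    using that \<phi>_mul by (simp add: \<Phi>_def enc_mul fun_eq_iff)
  have \<Phi>_one: "\<Phi> \<one>\<^bsub>\<Gamma>\<^esub> = id" using \<phi>_one by (simp add: \<Phi>_def one'_def[symmetric] fun_eq_iff)
  have bij: "bij (\<Phi> g)" if g: "g \<in> carrier \<Gamma>" for g
  proof (rule o_bij)
    show "\<Phi> (inv\<^bsub>\<Gamma>\<^esub> g) \<circ> \<Phi> g = id" "\<Phi> g \<circ> \<Phi> (inv\<^bsub>\<Gamma>\<^esub> g) = id"
      using g \<Phi>_one by (simp_all flip: \<Phi>_mul)
  qed
  interpret Bij: group "BijGroup (UNIV :: cantor set)" by (rule group_BijGroup)
  have "continuous_action \<Gamma> \<Phi>"
  proof (unfold_locales)
    show "\<Phi> \<in> hom \<Gamma> (BijGroup UNIV)"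
      using bij \<Phi>_mul by (auto simp: hom_def BijGroup_def Bij_def compose_def fun_eq_iff)
    show "continuous_on UNIV (\<Phi> g)" if "g \<in> carrier \<Gamma>" for g using \<phi>_cont by (simp add: \<Phi>_def)
  qed
  moreover have "free_action \<Gamma> \<Phi>"
    unfolding free_action_def
  proof (intro ballI impI allI)
    fix g x assume g: "g \<in> carrier \<Gamma>" "g \<noteq> \<one>\<^bsub>\<Gamma>\<^esub>"
    then have "enc g \<noteq> one'" unfolding one'_def by (metis dec_enc \<Gamma>.one_closed)
    then show "\<Phi> g x \<noteq> x" using \<phi>_free by (simp add: \<Phi>_def)
  qed
  moreover have "minimal_action \<Gamma> \<Phi>"
    unfolding minimal_action_def
  proof
    fix x
    have "Group_Action.orbit \<Gamma> \<Phi> x = (\<lambda>f. f x) ` (\<Phi> ` carrier \<Gamma>)" by (auto simp: orbit_def)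
    also have "\<dots> = range (\<lambda>g. \<phi> g x)" unfolding range by auto
    finally show "closure (Group_Action.orbit \<Gamma> \<Phi> x) = UNIV" using \<phi>_min by simp
  qed
  moreover have "ergodic_invariant_borel_prob \<Gamma> \<Phi> m" if m: "N.ergodic_for \<phi> m" for m
    unfolding ergodic_invariant_borel_prob_def invariant_borel_prob_def
  proof (intro conjI ballI impI)
    show "prob_space m" "sets m = sets borel" using m by (auto simp: N.ergodic_for_def)
    show "distr m m (\<Phi> g) = m" for g using m by (simp add: N.ergodic_for_def \<Phi>_def)
    fix A :: "cantor set" assume A: "A \<in> sets borel" "\<forall>g\<in>carrier \<Gamma>. \<Phi> g -` A = A"
    have "\<phi> n -` A = A" for n
    proof -
      have "\<phi> n \<in> \<Phi> ` carrier \<Gamma>" unfolding range by blast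
      then obtain g where "g \<in> carrier \<Gamma>" "\<phi> n = \<Phi> g" by blast
      then show ?thesis using A(2) by simp
    qed
    then show "measure m A = 0 \<or> measure m A = 1" using m A(1) by (auto simp: N.ergodic_for_def)
  qed
  ultimately show ?thesis using erg by blast
qed

end
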